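(* Let $H:T^{\ast}Q\to\mathbb{R}$ be a simple function on the cotangent bundle of a manifold $Q$ and let $W\subset T^{\ast}Q$ be a linear subbundle. Given a simple function $\hat H:T^{\ast}Q\to\mathbb{R}$, there exist a non-negative function $\mu:T^{\ast}Q\to\mathbb{R}$ and a fiber preserving map $y:T^{\ast}Q\to T^{\ast}Q$ such that $$\langle y(\alpha),\mathbb{F}\hat H(\alpha)\rangle=-\mu(\alpha)-\{\hat H,H\}(\alpha)\quad\text{and}\quad y(\alpha)\in W_{\pi(\alpha)}\qquad\forall\alpha\in T^{\ast}Q,$$ if and only if $$\{\hat H,H\}(\sigma)=0\quad\forall\sigma\in\hat W,\qquad\text{where }\hat W:=\mathbb{F}\hat H^{-1}(W^0).$$
   Context: All manifolds are smooth and finite dimensional and all maps are smooth. $\pi:T^{\ast}Q\to Q$ is the projection. A function on $T^{\ast}Q$ is simple if it has the form $\mathfrak{H}+h\circ\pi$ with $h\in C^\infty(Q)$ and $\mathfrak{H}(\alpha)=\frac12\langle\alpha,\rho^\sharp(\alpha)\rangle$ for a Riemannian metric $\rho$ on $Q$. The fiber derivative $\mathbb{F}F:T^{\ast}Q\to TQ$ of $F:T^{\ast}Q\to\mathbb{R}$ is given by $\langle\sigma,\mathbb{F}F(\alpha)\rangle=\frac{d}{ds}|_{s=0}F(\alpha+s\sigma)$; for a simple function it is the bundle isomorphism $\rho^\sharp$. $W^0\subset TQ$ is the annihilator of $W$. $\{F,G\}=\frac{\partial F}{\partial q^i}\frac{\partial G}{\partial p_i}-\frac{\partial G}{\partial q^i}\frac{\partial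 F}{\partial p_i}$ is the canonical Poisson bracket. Fiber preserving means $\pi\circ y=\pi$. *)

theory Defs
  imports "HOL-Analysis.Analysis"
begin

text \<open>
  The model space is a real inner product space with a chosen finite orthonormal basis \<open>B\<close>, that is,
  Euclidean space of dimension \<open>card B\<close> with Cartesian coordinates \<open>x \<bullet> b\<close>. The class
  \<open>euclidean_space\<close> is not used because it excludes dimension 0.
\<close>

definition orthonormal_basis :: "'e::real_inner set \<Rightarrow> bool" where
  "orthonormal_basis B \<longleftrightarrow>
     finite B \<and> (\<forall>b\<in>B. \<forall>b'\<in>B. b \<bullet> b' = (if b = b' then 1 else 0)) \<and> span B = UNIV"

text \<open>
  Both notions below are meant for open \<open>S\<close> in a finite dimensional space, where testing the
  derivative on each fixed vector \<open>v\<close> is the same as testing it in operator norm.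
\<close>

primrec Ck_on :: "nat \<Rightarrow> 'a::real_normed_vector set \<Rightarrow> ('a \<Rightarrow> 'b::real_normed_vector) \<Rightarrow> bool" where
  "Ck_on 0 S f \<longleftrightarrow> continuous_on S f"
| "Ck_on (Suc k) S f \<longleftrightarrow> (\<forall>x\<in>S. f differentiable (at x)) \<and>
     (\<forall>v. Ck_on k S (\<lambda>x. frechet_derivative f (at x) v))"

definition smooth_on :: "'a::real_normed_vector set \<Rightarrow> ('a \<Rightarrow> 'b::real_normed_vector) \<Rightarrow> bool" where
  "smooth_on S f \<longleftrightarrow> (\<forall>k. Ck_on k S f)"

text \<open>A chart is a pair of a domain and a coordinate map; only the values on the domain matter.\<close>

type_synonym ('m, 'e) chart = "'m set \<times> ('m \<Rightarrow> 'e)"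

definition chart_inv :: "('m, 'e) chart \<Rightarrow> 'e \<Rightarrow> 'm" where
  "chart_inv c = inv_into (fst c) (snd c)"

definition transition :: "('m, 'e) chart \<Rightarrow> ('m, 'e) chart \<Rightarrow> 'e \<Rightarrow> 'e" where
  "transition c d = snd d \<circ> chart_inv c"

definition points :: "('m, 'e) chart set \<Rightarrow> 'm set" where
  "points A = (\<Union>c\<in>A. fst c)"

definition smooth_manifold :: "'q topology \<Rightarrow> ('q, 'e::real_inner) chart set \<Rightarrow> bool" where
  "smooth_manifold X A \<longleftrightarrow>
     Hausdorff_space X \<and> second_countable X \<and> points A = topspace X \<and>
     (\<forall>c\<in>A. openin X (fst c) \<and> open (snd c ` fst c) \<and>
        homeomorphic_map (subtopology X (fst c)) (top_of_set (snd c ` fst c)) (snd c)) \<and>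
     (\<forall>c\<in>A. \<forall>d\<in>A. smooth_on (snd c ` (fst c \<inter> fst d)) (transition c d))"

text \<open>
  The openness condition, for all charts, is the continuity of \<open>f\<close>; phrased this way, the
  definition needs the atlases only and no topology on the two manifolds.
\<close>

definition smooth_map ::
  "('m, 'e::real_normed_vector) chart set \<Rightarrow> ('n, 'f::real_normed_vector) chart set \<Rightarrow> ('m \<Rightarrow> 'n) \<Rightarrow> bool"
  where
  "smooth_map A A' f \<longleftrightarrow> f ` points A \<subseteq> points A' \<and>
     (\<forall>c\<in>A. \<forall>d\<in>A'.
        open (snd c ` (fst c \<inter> f -` fst d)) \<and>
        smooth_on (snd c ` (fst c \<inter> f -` fst d)) (snd d \<circ> f \<circ> chart_inv c))"

definition real_atlas :: "(real, real) chart set" where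
  "real_atlas = {(UNIV, id)}"

definition open_submanifold :: "('m, 'e) chart set \<Rightarrow> 'm set \<Rightarrow> ('m, 'e) chart set" where
  "open_submanifold A U = (\<lambda>c. (U \<inter> fst c, snd c)) ` A"

text \<open>
  A tangent vector at \<open>q\<close> is the family of its components in all charts around \<open>q\<close>, related by the
  derivatives of the transition maps; the components in the remaining charts are set to 0.
  A covector is a linear functional on the tangent space, set to 0 off the tangent space. The vector
  space operations in the fibers are pointwise. Elements of both bundles are pairs of a base point
  and a vector or covector.
\<close>

type_synonym ('q, 'e) tvec = "('q, 'e) chart \<Rightarrow> 'e"
type_synonym ('q, 'e) covec = "('q, 'e) tvec \<Rightarrow> real"

definition charts_at :: "('q, 'e) chart set \<Rightarrow> 'q \<Rightarrow> ('q, 'e) chart set" where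
  "charts_at A q = {c\<in>A. q \<in> fst c}"

definition tangent_space :: "('q, 'e::real_inner) chart set \<Rightarrow> 'q \<Rightarrow> ('q, 'e) tvec set" where
  "tangent_space A q = {v.
     (\<forall>c\<in>charts_at A q. \<forall>d\<in>charts_at A q.
        v d = frechet_derivative (transition c d) (at (snd c q)) (v c)) \<and>
     (\<forall>c. c \<notin> charts_at A q \<longrightarrow> v c = 0)}"

definition tangent_bundle :: "('q, 'e::real_inner) chart set \<Rightarrow> ('q \<times> ('q, 'e) tvec) set" where
  "tangent_bundle A = {(q, v). q \<in> points A \<and> v \<in> tangent_space A q}"

definition tangent_linear ::
  "('q, 'e::real_inner) chart set \<Rightarrow> 'q \<Rightarrow> (('q, 'e) tvec \<Rightarrow> real) \<Rightarrow> bool" where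
  "tangent_linear A q f \<longleftrightarrow>
     (\<forall>v\<in>tangent_space A q. \<forall>w\<in>tangent_space A q. f (\<lambda>c. v c + w c) = f v + f w) \<and>
     (\<forall>s. \<forall>v\<in>tangent_space A q. f (\<lambda>c. s *\<^sub>R v c) = s * f v)"

definition cotangent_space :: "('q, 'e::real_inner) chart set \<Rightarrow> 'q \<Rightarrow> ('q, 'e) covec set" where
  "cotangent_space A q = {a. tangent_linear A q a \<and> (\<forall>v. v \<notin> tangent_space A q \<longrightarrow> a v = 0)}"

definition cotangent_bundle :: "('q, 'e::real_inner) chart set \<Rightarrow> ('q \<times> ('q, 'e) covec) set" where
  "cotangent_bundle A = {(q, a). q \<in> points A \<and> a \<in> cotangent_space A q}"

abbreviation bundle_proj :: "'q \<times> 'v \<Rightarrow> 'q" where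
  "bundle_proj \<equiv> fst"

text \<open>Meaningful only for a covector and a vector over the same base point.\<close>

definition pairing :: "'q \<times> ('q, 'e) covec \<Rightarrow> 'q \<times> ('q, 'e) tvec \<Rightarrow> real" where
  "pairing \<alpha> X = snd \<alpha> (snd X)"

text \<open>The tangent vector at \<open>q\<close> whose component in the chart \<open>c\<close> is \<open>u\<close>.\<close>

definition coord_tvec ::
  "('q, 'e::real_inner) chart set \<Rightarrow> ('q, 'e) chart \<Rightarrow> 'q \<Rightarrow> 'e \<Rightarrow> ('q, 'e) tvec" where
  "coord_tvec A c q u =
     (\<lambda>d. if d \<in> charts_at A q then frechet_derivative (transition c d) (at (snd c q)) u else 0)"

text \<open>Canonical coordinates \<open>(q\<^sup>i, p\<^sub>i)\<close>, with \<open>p\<^sub>i\<close> the value of the covector on \<open>\<partial>/\<partial>q\<^sup>i\<close>.\<close>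

definition cotangent_chart :: "'e::real_inner set \<Rightarrow> ('q, 'e) chart set \<Rightarrow> ('q, 'e) chart
    \<Rightarrow> ('q \<times> ('q, 'e) covec, 'e \<times> 'e) chart" where
  "cotangent_chart B A c =
     ({\<alpha>\<in>cotangent_bundle A. bundle_proj \<alpha> \<in> fst c},
      \<lambda>(q, a). (snd c q, \<Sum>b\<in>B. a (coord_tvec A c q b) *\<^sub>R b))"

definition cotangent_atlas :: "'e::real_inner set \<Rightarrow> ('q, 'e) chart set
    \<Rightarrow> ('q \<times> ('q, 'e) covec, 'e \<times> 'e) chart set" where
  "cotangent_atlas B A = cotangent_chart B A ` A"

definition riemannian_metric :: "('q, 'e::real_inner) chart set
    \<Rightarrow> ('q \<Rightarrow> ('q, 'e) tvec \<Rightarrow> ('q, 'e) tvec \<Rightarrow> real) \<Rightarrow> bool" where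
  "riemannian_metric A \<rho> \<longleftrightarrow>
     (\<forall>q\<in>points A.
        (\<forall>v\<in>tangent_space A q. tangent_linear A q (\<rho> q v)) \<and>
        (\<forall>v\<in>tangent_space A q. \<forall>w\<in>tangent_space A q. \<rho> q v w = \<rho> q w v) \<and>
        (\<forall>v\<in>tangent_space A q. v \<noteq> (\<lambda>_. 0) \<longrightarrow> \<rho> q v v > 0)) \<and>
     (\<forall>c\<in>A. \<forall>u w. smooth_on (snd c ` fst c)
        (\<lambda>x. let q = chart_inv c x in \<rho> q (coord_tvec A c q u) (coord_tvec A c q w)))"

definition sharp :: "('q, 'e::real_inner) chart set
    \<Rightarrow> ('q \<Rightarrow> ('q, 'e) tvec \<Rightarrow> ('q, 'e) tvec \<Rightarrow> real)
    \<Rightarrow> 'q \<times> ('q, 'e) covec \<Rightarrow> 'q \<times> ('q, 'e) tvec" where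
  "sharp A \<rho> = (\<lambda>(q, a).
     (q, THE v. v \<in> tangent_space A q \<and> (\<forall>w\<in>tangent_space A q. \<rho> q v w = a w)))"

definition simple_hamiltonian ::
  "('q, 'e::real_inner) chart set \<Rightarrow> ('q \<times> ('q, 'e) covec \<Rightarrow> real) \<Rightarrow> bool" where
  "simple_hamiltonian A F \<longleftrightarrow>
     (\<exists>\<rho> h. riemannian_metric A \<rho> \<and> smooth_map A real_atlas h \<and>
        (\<forall>\<alpha>\<in>cotangent_bundle A. F \<alpha> = 1/2 * pairing \<alpha> (sharp A \<rho> \<alpha>) + h (bundle_proj \<alpha>)))"

definition fiber_derivative :: "('q, 'e::real_inner) chart set
    \<Rightarrow> ('q \<times> ('q, 'e) covec \<Rightarrow> real) \<Rightarrow> 'q \<times> ('q, 'e) covec \<Rightarrow> 'q \<times> ('q, 'e) tvec" where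
  "fiber_derivative A F = (\<lambda>(q, a).
     (q, THE v. v \<in> tangent_space A q \<and>
        (\<forall>\<sigma>\<in>cotangent_space A q.
           ((\<lambda>s. F (q, \<lambda>w. a w + s * \<sigma> w)) has_real_derivative \<sigma> v) (at 0))))"

definition fiber :: "('q \<times> 'v) set \<Rightarrow> 'q \<Rightarrow> ('q \<times> 'v) set" where
  "fiber W q = {\<alpha>\<in>W. bundle_proj \<alpha> = q}"

text \<open>Locally, \<open>W\<close> is spanned by smooth, pointwise linearly independent sections \<open>\<omega> 0, \<dots>, \<omega> (k - 1)\<close>.\<close>

definition linear_subbundle :: "'e::real_inner set \<Rightarrow> 'q topology \<Rightarrow> ('q, 'e) chart set
    \<Rightarrow> ('q \<times> ('q, 'e) covec) set \<Rightarrow> bool" where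
  "linear_subbundle B X A W \<longleftrightarrow> W \<subseteq> cotangent_bundle A \<and>
     (\<forall>q\<^sub>0\<in>points A. \<exists>U (k::nat) \<omega>. openin X U \<and> q\<^sub>0 \<in> U \<and>
        (\<forall>i<k. smooth_map (open_submanifold A U) (cotangent_atlas B A) (\<lambda>q. (q, \<omega> i q))) \<and>
        (\<forall>q\<in>U.
           (\<forall>r. (\<lambda>v. \<Sum>i<k. r i * \<omega> i q v) = (\<lambda>_. 0) \<longrightarrow> (\<forall>i<k. r i = 0)) \<and>
           fiber W q = {(q, \<lambda>v. \<Sum>i<k. r i * \<omega> i q v) | r. True}))"

definition annihilator :: "('q, 'e::real_inner) chart set
    \<Rightarrow> ('q \<times> ('q, 'e) covec) set \<Rightarrow> ('q \<times> ('q, 'e) tvec) set" where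
  "annihilator A W =
     {X\<in>tangent_bundle A. \<forall>\<alpha>\<in>fiber W (bundle_proj X). pairing \<alpha> X = 0}"

definition directional_derivative :: "('a::real_normed_vector \<Rightarrow> real) \<Rightarrow> 'a \<Rightarrow> 'a \<Rightarrow> real" where
  "directional_derivative f x u = deriv (\<lambda>t. f (x + t *\<^sub>R u)) 0"

definition coordinate_bracket :: "'e::real_inner set
    \<Rightarrow> ('e \<times> 'e \<Rightarrow> real) \<Rightarrow> ('e \<times> 'e \<Rightarrow> real) \<Rightarrow> 'e \<times> 'e \<Rightarrow> real" where
  "coordinate_bracket B f g z =
     (\<Sum>b\<in>B. directional_derivative f z (b, 0) * directional_derivative g z (0, b)
           - directional_derivative g z (b, 0) * directional_derivative f z (0, b))"

text \<open>The common value of the coordinate expression in all canonical charts around \<open>\<alpha>\<close>.\<close>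

definition poisson_bracket :: "'e::real_inner set \<Rightarrow> ('q, 'e) chart set
    \<Rightarrow> ('q \<times> ('q, 'e) covec \<Rightarrow> real) \<Rightarrow> ('q \<times> ('q, 'e) covec \<Rightarrow> real)
    \<Rightarrow> 'q \<times> ('q, 'e) covec \<Rightarrow> real" where
  "poisson_bracket B A F G \<alpha> = (THE r. \<forall>C\<in>charts_at (cotangent_atlas B A) \<alpha>.
     r = coordinate_bracket B (F \<circ> chart_inv C) (G \<circ> chart_inv C) (snd C \<alpha>))"

end

theory Submission
  imports Defs
begin

text \<open>
  If \<open>\<mu>\<close> and \<open>y\<close> exist, then on \<open>What\<close>, the preimage of the annihilator of \<open>W\<close> under the
  fiber derivative of \<open>Hhat\<close>, the pairing with \<open>y\<close> vanishes, so the bracket is nonpositive. A simple function is even on each fiber, so the bracket is odd on the fibers; since the fibers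
  of \<open>What\<close> are linear, it must vanish.

  Conversely take \<open>\<mu> = 0\<close>, let \<open>F\<close> be the bracket and \<open>\<beta>\<close> the orthogonal projection of \<open>\<alpha>\<close> to \<open>W\<close> with
  respect to the cometric of \<open>Hhat\<close>, so that \<open>\<alpha> - \<beta>\<close> lies in \<open>What\<close> and \<open>F (\<alpha> - \<beta>) = 0\<close>. Hadamard's
  lemma on the segment from \<open>\<alpha> - \<beta>\<close> to \<open>\<alpha>\<close> gives \<open>F \<alpha> = N \<alpha> \<beta>\<close>, where \<open>N \<alpha> \<sigma>\<close> is the mean derivative of
  \<open>F\<close> along the segment in the direction \<open>\<sigma>\<close>. The covector \<open>y\<close> in \<open>W\<close> that represents
  \<open>-N \<alpha>\<close> on \<open>W\<close> with respect to the cometric solves the equation; it is defined without choices, hence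
  globally, and no partition of unity is needed.
\<close>

section \<open>Smooth functions on open sets\<close>

text \<open>The obstacle is smoothness of \<open>y\<close> across the preimage of the annihilator.
  There \<open>\<beta>\<close> is 0, and the obvious candidate, \<open>\<beta>\<close> times
  \<open>- F \<alpha>\<close> over the squared length of \<open>\<beta>\<close>, takes the form 0/0.
  Writing \<open>F \<alpha>\<close> as a linear functional \<open>N \<alpha>\<close> evaluated at
  \<open>\<beta>\<close> removes the division: a covector \<open>y\<close> in \<open>W\<close> pairs
  with \<open>\<alpha>\<close> as it pairs with \<open>\<beta>\<close>, because
  \<open>\<alpha> - \<beta>\<close> is orthogonal to \<open>W\<close>, and for the representative of
  \<open>- N \<alpha>\<close> this value is \<open>- N \<alpha> \<beta> = - F \<alpha>\<close>. The
  mean over the segment needs no integral with parameters. In canonical coordinates the base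
  derivatives of a simple function are quadratic in the momentum and its fiber derivatives are
  linear, so the bracket is cubic on each fiber, and the three nodes of Simpson's rule give the mean
  exactly. The projection and \<open>y\<close> are characterized by conditions whose solution is
  unique by positive definiteness; local frames of \<open>W\<close> serve only to prove existence
  and smoothness near a point.\<close>

lemma Ck_on_Suc_imp: "Ck_on (Suc k) S f \<Longrightarrow> Ck_on k S f"
proof (induction k arbitrary: f)
  case 0
  then show ?case
    by (auto intro!: continuous_at_imp_continuous_on differentiable_imp_continuous_within)
next
  case (Suc k)
  then show ?case by (metis Ck_on.simps(2))
qed

lemma Ck_on_subset: "Ck_on k S f \<Longrightarrow> T \<subseteq> S \<Longrightarrow> Ck_on k T f"
  by (induction k arbitrary: f) (auto intro: continuous_on_subset)

lemma Ck_on_cong: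
  assumes "open S" "\<And>x. x \<in> S \<Longrightarrow> f x = g x" "Ck_on k S f"
  shows "Ck_on k S g"
  using assms(2,3)
proof (induction k arbitrary: f g)
  case 0
  then show ?case by (metis Ck_on.simps(1) continuous_on_cong)
next
  case (Suc k)
  have *: "(g has_derivative frechet_derivative f (at x)) (at x)" if "x \<in> S" for x
    using Suc.prems that assms(1)
    by (metis Ck_on.simps(2) frechet_derivative_works has_derivative_transform_within_open)
  show ?case
    unfolding Ck_on.simps
  proof safe
    show "g differentiable at x" if "x \<in> S" for x
      using *[OF that] by (auto simp: differentiable_def)
    have "frechet_derivative f (at x) = frechet_derivative g (at x)" if "x \<in> S" for x
      by (rule frechet_derivative_at[OF *[OF that]])
    moreover have "Ck_on k S (\<lambda>x. frechet_derivative f (at x) v)" for v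
      using Suc.prems by simp
    ultimately show "Ck_on k S (\<lambda>x. frechet_derivative g (at x) v)" for v
      using Suc.IH[of "\<lambda>x. frechet_derivative f (at x) v" "\<lambda>x. frechet_derivative g (at x) v"] by simp
  qed
qed

text \<open>On an open set any explicit derivative formula may stand in for
  \<open>frechet_derivative\<close>; this drives the inductions on the order below.\<close>

lemma Ck_on_SucI:
  assumes "open S" "\<And>x. x \<in> S \<Longrightarrow> (f has_derivative f' x) (at x)" "\<And>v. Ck_on k S (\<lambda>x. f' x v)"
  shows "Ck_on (Suc k) S f"
  unfolding Ck_on.simps
proof safe
  show "f differentiable at x" if "x \<in> S" for x
    using assms(2)[OF that] by (auto simp: differentiable_def)
  show "Ck_on k S (\<lambda>x. frechet_derivative f (at x) v)" for v
    by (rule Ck_on_cong[OF assms(1) _ assms(3)]) (simp flip: frechet_derivative_at[OF assms(2)])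
qed

lemma Ck_on_SucD:
  assumes "Ck_on (Suc k) S f"
  shows "x \<in> S \<Longrightarrow> (f has_derivative frechet_derivative f (at x)) (at x)"
    and "Ck_on k S (\<lambda>x. frechet_derivative f (at x) v)"
  using assms by (auto simp: frechet_derivative_works)

lemma Ck_on_local:
  assumes "\<And>x. x \<in> S \<Longrightarrow> \<exists>T. open T \<and> x \<in> T \<and> Ck_on k T f"
  shows "Ck_on k S f"
  using assms
proof (induction k arbitrary: f)
  case 0
  then show ?case
    by (metis Ck_on.simps(1) continuous_at_imp_continuous_on continuous_on_eq_continuous_at)
next
  case (Suc k)
  then show ?case unfolding Ck_on.simps by metis
qed

lemma Ck_on_const: "Ck_on k S (\<lambda>x. c)"
  by (induction k arbitrary: c) auto

lemma Ck_on_bounded_linear: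
  assumes "open S" "bounded_linear f"
  shows "Ck_on k S f"
proof (cases k)
  case 0
  then show ?thesis using assms(2) by (simp add: linear_continuous_on)
next
  case (Suc m)
  then show ?thesis
    using Ck_on_SucI[OF assms(1) bounded_linear_imp_has_derivative[OF assms(2)] Ck_on_const] by metis
qed

lemma Ck_on_add:
  assumes "open S" "Ck_on k S f" "Ck_on k S g"
  shows "Ck_on k S (\<lambda>x. f x + g x)"
  using assms(2,3)
proof (induction k arbitrary: f g)
  case 0
  then show ?case by (auto intro: continuous_intros)
next
  case (Suc k)
  show ?case
    by (rule Ck_on_SucI[OF assms(1) has_derivative_add[OF Ck_on_SucD(1)[OF Suc.prems(1)]
            Ck_on_SucD(1)[OF Suc.prems(2)]]])
      (auto intro!: Suc.IH Ck_on_SucD(2) Suc.prems)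
qed

lemma Ck_on_sum:
  assumes "open S" "\<And>i. i \<in> I \<Longrightarrow> Ck_on k S (f i)"
  shows "Ck_on k S (\<lambda>x. \<Sum>i\<in>I. f i x)"
  using assms(2)
  by (induction I rule: infinite_finite_induct) (auto intro: Ck_on_const Ck_on_add[OF assms(1)])

text \<open>The Leibniz formula produces two bilinear terms of the same kind, so the induction
  ranges over all \<open>f\<close> and \<open>g\<close>. Scaling, inner products and multiplication
  are instances.\<close>

lemma Ck_on_bilinear:
  assumes "open S" "bounded_bilinear h" "Ck_on k S f" "Ck_on k S g"
  shows "Ck_on k S (\<lambda>x. h (f x) (g x))"
  using assms(3,4)
proof (induction k arbitrary: f g)
  case 0
  then show ?case by (auto intro: bounded_bilinear.continuous_on[OF assms(2)])
next
  case (Suc k)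
  show ?case
  proof (rule Ck_on_SucI[OF assms(1)])
    show "((\<lambda>x. h (f x) (g x)) has_derivative
        (\<lambda>v. h (f x) (frechet_derivative g (at x) v) + h (frechet_derivative f (at x) v) (g x))) (at x)"
      if "x \<in> S" for x
      by (rule bounded_bilinear.FDERIV[OF assms(2) Ck_on_SucD(1)[OF Suc.prems(1) that]
            Ck_on_SucD(1)[OF Suc.prems(2) that]])
    show "Ck_on k S (\<lambda>x. h (f x) (frechet_derivative g (at x) v) + h (frechet_derivative f (at x) v) (g x))"
      for v
      by (intro Ck_on_add assms(1) Suc.IH Ck_on_SucD(2)[OF Suc.prems(1)] Ck_on_SucD(2)[OF Suc.prems(2)]
          Ck_on_Suc_imp[OF Suc.prems(1)] Ck_on_Suc_imp[OF Suc.prems(2)])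
  qed
qed

text \<open>The derivative of \<open>1 / f\<close> is a product of \<open>- 1\<close>, two factors
  \<open>1 / f\<close> and a derivative of \<open>f\<close>; all of these have order
  \<open>k\<close> by induction, so \<open>f\<close> can stay fixed.\<close>

lemma Ck_on_inverse:
  fixes f :: "'a::real_normed_vector \<Rightarrow> real"
  assumes "open S" "\<And>x. x \<in> S \<Longrightarrow> f x \<noteq> 0" "Ck_on k S f"
  shows "Ck_on k S (\<lambda>x. inverse (f x))"
  using assms(3)
proof (induction k)
  case 0
  then show ?case using assms by (auto intro: continuous_intros)
next
  case (Suc k)
  show ?case
  proof (rule Ck_on_SucI[OF assms(1)])
    show "((\<lambda>x. inverse (f x)) has_derivative
        (\<lambda>v. (-1) * (inverse (f x) * frechet_derivative f (at x) v * inverse (f x)))) (at x)"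
      if "x \<in> S" for x
      using Deriv.has_derivative_inverse[OF assms(2)[OF that] Ck_on_SucD(1)[OF Suc.prems that]] by simp
    show "Ck_on k S (\<lambda>x. (-1) * (inverse (f x) * frechet_derivative f (at x) v * inverse (f x)))" for v
      by (intro Ck_on_bilinear[OF assms(1) bounded_bilinear_mult] Ck_on_const Suc.IH
          Ck_on_Suc_imp[OF Suc.prems] Ck_on_SucD(2)[OF Suc.prems])
  qed
qed

section \<open>Expansion in an orthonormal basis and the chain rule\<close>

lemma orthonormal_basis_expand:
  assumes "orthonormal_basis B"
  shows "u = (\<Sum>b\<in>B. (u \<bullet> b) *\<^sub>R b)"
proof -
  have fin: "finite B" and "u \<in> span B" using assms by (auto simp: orthonormal_basis_def)
  then obtain r where r: "u = (\<Sum>b\<in>B. r b *\<^sub>R b)" by (auto simp: span_finite)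
  have "u \<bullet> b = r b" if "b \<in> B" for b
  proof -
    have "u \<bullet> b = (\<Sum>b'\<in>B. r b' * (b' \<bullet> b))"
      by (simp add: r inner_sum_left)
    also have "\<dots> = (\<Sum>b'\<in>B. if b' = b then r b' else 0)"
      using assms that by (intro sum.cong) (auto simp: orthonormal_basis_def)
    finally show ?thesis using fin that by simp
  qed
  then show ?thesis using r by (metis (no_types, lifting) sum.cong)
qed

lemma orthonormal_basis_linear_expand:
  fixes B :: "'a::real_inner set" and f :: "'a::real_inner \<Rightarrow> 'b::real_vector"
  assumes "orthonormal_basis B" "linear f"
  shows "f u = (\<Sum>b\<in>B. (u \<bullet> b) *\<^sub>R f b)"
proof -
  have "f u = f (\<Sum>b\<in>B. (u \<bullet> b) *\<^sub>R b)"
    by (rule arg_cong[OF orthonormal_basis_expand[OF assms(1)]])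
  then show ?thesis by (simp add: linear_sum[OF assms(2)] linear_scale[OF assms(2)])
qed

lemma orthonormal_basis_prod:
  assumes "orthonormal_basis B" "orthonormal_basis C"
  shows "orthonormal_basis ((\<lambda>b. (b, 0)) ` B \<union> (\<lambda>c. (0, c)) ` C)" (is "orthonormal_basis ?D")
proof -
  have ne: "0 \<notin> B" "0 \<notin> C" using assms by (metis inner_zero_left orthonormal_basis_def zero_neq_one)+
  have "z \<in> span ?D" for z :: "'a \<times> 'b"
  proof -
    have "z = (\<Sum>b\<in>B. (fst z \<bullet> b) *\<^sub>R (b, 0)) + (\<Sum>c\<in>C. (snd z \<bullet> c) *\<^sub>R (0, c))"
      using orthonormal_basis_expand[OF assms(1), of "fst z", symmetric]
        orthonormal_basis_expand[OF assms(2), of "snd z", symmetric]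
      by (intro prod_eqI) (simp_all add: fst_sum snd_sum)
    moreover have "\<dots> \<in> span ?D"
      by (intro span_add span_sum span_scale span_base) auto
    ultimately show ?thesis by simp
  qed
  then have "span ?D = UNIV" by auto
  moreover have "\<forall>b\<in>?D. \<forall>b'\<in>?D. b \<bullet> b' = (if b = b' then 1 else 0)"
  proof -
    have "b \<bullet> b' = (if b = b' then 1 else 0)" if "b \<in> B" "b' \<in> B" for b b'
      using assms(1) that by (simp add: orthonormal_basis_def)
    moreover have "c \<bullet> c' = (if c = c' then 1 else 0)" if "c \<in> C" "c' \<in> C" for c c'
      using assms(2) that by (simp add: orthonormal_basis_def)
    ultimately show ?thesis using ne by (simp add: ball_Un inner_Pair)
  qed
  ultimately show ?thesis using assms by (simp add: orthonormal_basis_def)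
qed

text \<open>By the chain rule \<open>f\<close> is differentiated in the direction
  \<open>frechet_derivative g (at x) v\<close>, which moves with \<open>x\<close>, whereas
  \<open>Ck_on\<close> controls fixed directions only. Expanding the direction in \<open>B\<close>
  leaves the fixed directions \<open>b\<close> with coefficients that depend on
  \<open>x\<close>.\<close>

lemma Ck_on_compose:
  fixes B :: "'b::real_inner set" and g :: "'a::real_normed_vector \<Rightarrow> 'b::real_inner" and f :: "'b \<Rightarrow> 'c::real_normed_vector"
  assumes "orthonormal_basis B" "open S" "open T" "g ` S \<subseteq> T" "Ck_on k T f" "Ck_on k S g"
  shows "Ck_on k S (\<lambda>x. f (g x))"
  using assms(5,6)
proof (induction k arbitrary: f)
  case 0
  then show ?case using assms(4) by (auto intro: continuous_on_compose2)
next
  case (Suc k)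
  let ?f' = "\<lambda>x. frechet_derivative f (at (g x))" and ?g' = "\<lambda>x. frechet_derivative g (at x)"
  show ?case
  proof (rule Ck_on_SucI[OF assms(2)])
    show "((\<lambda>x. f (g x)) has_derivative (\<lambda>v. \<Sum>b\<in>B. (?g' x v \<bullet> b) *\<^sub>R ?f' x b)) (at x)" if "x \<in> S" for x
    proof -
      have "g x \<in> T" using that assms(4) by auto
      note f' = Ck_on_SucD(1)[OF Suc.prems(1) this]
      have "(\<lambda>v. ?f' x (?g' x v)) = (\<lambda>v. \<Sum>b\<in>B. (?g' x v \<bullet> b) *\<^sub>R ?f' x b)"
        by (rule ext) (rule orthonormal_basis_linear_expand[OF assms(1) has_derivative_linear[OF f']])
      from this[symmetric] show ?thesis
        using has_derivative_compose[OF Ck_on_SucD(1)[OF Suc.prems(2) that] f'] by (simp only:)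
    qed
    show "Ck_on k S (\<lambda>x. \<Sum>b\<in>B. (?g' x v \<bullet> b) *\<^sub>R ?f' x b)" for v
      by (intro Ck_on_sum Ck_on_bilinear[OF _ bounded_bilinear_scaleR] Ck_on_bilinear[OF _ bounded_bilinear_inner]
          Ck_on_SucD(2)[OF Suc.prems(2)] Suc.IH[OF Ck_on_SucD(2)[OF Suc.prems(1)]] Ck_on_const assms(2)
          Ck_on_Suc_imp[OF Suc.prems(2)])
  qed
qed

section \<open>Closure rules for smooth functions\<close>

lemma smooth_onI: "(\<And>k. Ck_on k S f) \<Longrightarrow> smooth_on S f"
  and smooth_on_Ck: "smooth_on S f \<Longrightarrow> Ck_on k S f"
  by (auto simp: smooth_on_def)

lemma smooth_on_subset: "smooth_on S f \<Longrightarrow> T \<subseteq> S \<Longrightarrow> smooth_on T f"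
  unfolding smooth_on_def using Ck_on_subset by blast

lemma smooth_on_cong:
  assumes "open S" "\<And>x. x \<in> S \<Longrightarrow> f x = g x" "smooth_on S f"
  shows "smooth_on S g"
  using Ck_on_cong[OF assms(1,2)] assms(3) by (auto simp: smooth_on_def)

lemma smooth_on_local:
  assumes "\<And>x. x \<in> S \<Longrightarrow> \<exists>T. open T \<and> x \<in> T \<and> smooth_on T f"
  shows "smooth_on S f"
  unfolding smooth_on_def by (meson Ck_on_local assms smooth_on_def)

lemma smooth_on_const: "smooth_on S (\<lambda>x. c)"
  by (intro smooth_onI Ck_on_const)

lemma smooth_on_add:
  "open S \<Longrightarrow> smooth_on S f \<Longrightarrow> smooth_on S g \<Longrightarrow> smooth_on S (\<lambda>x. f x + g x)"
  by (auto simp: smooth_on_def intro: Ck_on_add)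

lemma smooth_on_sum:
  "open S \<Longrightarrow> (\<And>i. i \<in> I \<Longrightarrow> smooth_on S (f i)) \<Longrightarrow> smooth_on S (\<lambda>x. \<Sum>i\<in>I. f i x)"
  by (auto simp: smooth_on_def intro: Ck_on_sum)

lemma smooth_on_bilinear:
  "open S \<Longrightarrow> bounded_bilinear h \<Longrightarrow> smooth_on S f \<Longrightarrow> smooth_on S g \<Longrightarrow> smooth_on S (\<lambda>x. h (f x) (g x))"
  by (auto simp: smooth_on_def intro: Ck_on_bilinear)

lemmas smooth_on_scaleR = smooth_on_bilinear[OF _ bounded_bilinear_scaleR]
lemmas smooth_on_inner = smooth_on_bilinear[OF _ bounded_bilinear_inner]
lemmas smooth_on_mult = smooth_on_bilinear[OF _ bounded_bilinear_mult]

lemma smooth_on_diff: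
  assumes "open S" "smooth_on S f" "smooth_on S g"
  shows "smooth_on S (\<lambda>x. f x - g x)"
  using smooth_on_add[OF assms(1,2) smooth_on_scaleR[OF assms(1) smooth_on_const[of S "-1"] assms(3)]]
  by simp

lemma smooth_on_inverse:
  fixes f :: "'a::real_normed_vector \<Rightarrow> real"
  shows "open S \<Longrightarrow> (\<And>x. x \<in> S \<Longrightarrow> f x \<noteq> 0) \<Longrightarrow> smooth_on S f \<Longrightarrow> smooth_on S (\<lambda>x. inverse (f x))"
  by (auto simp: smooth_on_def intro: Ck_on_inverse)

lemma smooth_on_bounded_linear: "open S \<Longrightarrow> bounded_linear f \<Longrightarrow> smooth_on S f"
  by (auto simp: smooth_on_def intro: Ck_on_bounded_linear)

lemma smooth_on_compose:
  fixes B :: "'b::real_inner set" and g :: "'a::real_normed_vector \<Rightarrow> 'b::real_inner" and f :: "'b \<Rightarrow> 'c::real_normed_vector"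
  assumes "orthonormal_basis B" "open S" "open T" "g ` S \<subseteq> T" "smooth_on T f" "smooth_on S g"
  shows "smooth_on S (\<lambda>x. f (g x))"
  using assms by (auto simp: smooth_on_def intro: Ck_on_compose)

lemma smooth_on_linear:
  assumes "open S" "bounded_linear L" "smooth_on S f"
  shows "smooth_on S (\<lambda>x. L (f x))"
  \<comment> \<open>\<open>L\<close> is made bilinear as \<open>t *\<^sub>R L u\<close> and used at
    \<open>t = 1\<close>.\<close>
  using smooth_on_bilinear[OF assms(1)
      bounded_bilinear.comp[OF bounded_bilinear_scaleR bounded_linear_ident assms(2)]
      smooth_on_const[of S 1] assms(3)] by simp

lemma smooth_on_Pair:
  assumes "open S" "smooth_on S f" "smooth_on S g"
  shows "smooth_on S (\<lambda>x. (f x, g x))"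
proof -
  have "bounded_linear (\<lambda>x. (x, 0))" "bounded_linear (Pair 0)"
    by (auto intro: bounded_linear_Pair bounded_linear_ident bounded_linear_zero)
  then show ?thesis
    using smooth_on_add[OF assms(1) smooth_on_linear[OF assms(1) _ assms(2)]
      smooth_on_linear[OF assms(1) _ assms(3)], of "\<lambda>x. (x, 0)" "Pair 0"] by simp
qed

lemma smooth_on_derivative:
  assumes "smooth_on S f"
  shows "smooth_on S (\<lambda>x. frechet_derivative f (at x) v)"
  by (rule smooth_onI) (rule Ck_on_SucD(2)[OF smooth_on_Ck[OF assms]])

lemma smooth_on_has_derivative:
  assumes "smooth_on S f" "x \<in> S"
  shows "(f has_derivative frechet_derivative f (at x)) (at x)"
  using Ck_on_SucD(1)[OF smooth_on_Ck[OF assms(1)]] assms(2) by blast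

section \<open>Second derivatives and change of coordinates in the bracket\<close>

lemma has_derivative_along_line:
  assumes "(f has_derivative f') (at (a + s *\<^sub>R w))"
  shows "((\<lambda>s. f (a + s *\<^sub>R w)) has_real_derivative f' w) (at s)"
proof -
  have "((\<lambda>s. a + s *\<^sub>R w) has_derivative (\<lambda>r. r *\<^sub>R w)) (at s)"
    by (auto intro!: derivative_eq_intros)
  from has_derivative_compose[OF this assms]
  have "((\<lambda>s. f (a + s *\<^sub>R w)) has_derivative (\<lambda>r. f' (r *\<^sub>R w))) (at s)" .
  moreover have "(\<lambda>r. f' (r *\<^sub>R w)) = (*) (f' w)"
    using linear_scale[OF has_derivative_linear[OF assms]] by (simp add: fun_eq_iff mult.commute)
  ultimately show ?thesis by (simp add: has_field_derivative_def)
qed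

text \<open>Two mean value theorems: one in \<open>s\<close> for the difference in direction
  \<open>v\<close>, one in \<open>t\<close> for the derivative so obtained. The second difference is
  symmetric in \<open>u\<close> and \<open>v\<close>, which the next lemma exploits.\<close>

lemma second_difference_mean_value:
  fixes f :: "'a::real_normed_vector \<Rightarrow> real"
  assumes "Ck_on 2 S f" "0 < h"
    and in_S: "\<And>s t. 0 \<le> s \<Longrightarrow> s \<le> h \<Longrightarrow> 0 \<le> t \<Longrightarrow> t \<le> h \<Longrightarrow> x + s *\<^sub>R u + t *\<^sub>R v \<in> S"
  obtains s t where "0 < s" "s < h" "0 < t" "t < h"
    "f (x + h *\<^sub>R u + h *\<^sub>R v) - f (x + h *\<^sub>R u) - f (x + h *\<^sub>R v) + f x =
      h * h * frechet_derivative (\<lambda>y. frechet_derivative f (at y) u) (at (x + s *\<^sub>R u + t *\<^sub>R v)) v"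
proof -
  let ?D = "\<lambda>y. frechet_derivative f (at y)"
  let ?D2 = "\<lambda>y. frechet_derivative (\<lambda>y. ?D y u) (at y) v"
  have C: "Ck_on (Suc 1) S f" using assms(1) by (simp add: numeral_2_eq_2)
  have C': "Ck_on (Suc 0) S (\<lambda>y. ?D y u)" using Ck_on_SucD(2)[OF C] by simp
  have D: "((\<lambda>s. f (a + s *\<^sub>R w)) has_real_derivative ?D (a + s *\<^sub>R w) w) (at s)" if "a + s *\<^sub>R w \<in> S" for a s w
    by (rule has_derivative_along_line[OF Ck_on_SucD(1)[OF C that]])
  have D2: "((\<lambda>t. ?D (a + t *\<^sub>R v) u) has_real_derivative ?D2 (a + t *\<^sub>R v)) (at t)"
    if "a + t *\<^sub>R v \<in> S" for a t
    by (rule has_derivative_along_line[OF Ck_on_SucD(1)[OF C' that]])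
  let ?phi = "\<lambda>s. f ((x + h *\<^sub>R v) + s *\<^sub>R u) - f (x + s *\<^sub>R u)"
  let ?phi' = "\<lambda>s. ?D ((x + h *\<^sub>R v) + s *\<^sub>R u) u - ?D (x + s *\<^sub>R u) u"
  have "(?phi has_real_derivative ?phi' s) (at s)" if "0 \<le> s" "s \<le> h" for s
    using that in_S[of s h] in_S[of s 0] assms(2)
    by (intro DERIV_diff D) (simp_all add: algebra_simps)
  from MVT2[OF assms(2) this] obtain s where s: "0 < s" "s < h" "?phi h - ?phi 0 = h * ?phi' s" by auto
  let ?psi = "\<lambda>t. ?D ((x + s *\<^sub>R u) + t *\<^sub>R v) u"
  have "(?psi has_real_derivative ?D2 ((x + s *\<^sub>R u) + t *\<^sub>R v)) (at t)" if "0 \<le> t" "t \<le> h" for t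
    using that in_S[of s t] s by (intro D2) simp_all
  from MVT2[OF assms(2) this] obtain t where t: "0 < t" "t < h"
    "?psi h - ?psi 0 = h * ?D2 ((x + s *\<^sub>R u) + t *\<^sub>R v)" by auto
  have "?phi' s = ?psi h - ?psi 0" by (simp add: algebra_simps)
  then have "?phi h - ?phi 0 = h * (h * ?D2 ((x + s *\<^sub>R u) + t *\<^sub>R v))"
    using s(3) t(3) by simp
  then show ?thesis by (intro that[OF s(1,2) t(1,2)]) (simp add: algebra_simps)
qed

text \<open>Schwarz's theorem. One second difference over a small parallelogram equals
  \<open>h * h\<close> times either mixed derivative at some point of it, and by continuity these
  values are close to the ones at \<open>x\<close>.\<close>

lemma second_derivative_symmetric:
  fixes f :: "'a::real_normed_vector \<Rightarrow> real"
  assumes "open S" "Ck_on 2 S f" "x \<in> S"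
  shows "frechet_derivative (\<lambda>y. frechet_derivative f (at y) u) (at x) v =
    frechet_derivative (\<lambda>y. frechet_derivative f (at y) v) (at x) u"
proof (rule ccontr)
  define D2 where "D2 = (\<lambda>u v y. frechet_derivative (\<lambda>y. frechet_derivative f (at y) u) (at y) v)"
  assume "\<not> ?thesis"
  then have ne: "D2 u v x \<noteq> D2 v u x" by (simp add: D2_def)
  \<comment> \<open>Half the gap: values less than \<open>e\<close> away from the two sides cannot
    coincide.\<close>
  define e where "e = \<bar>D2 u v x - D2 v u x\<bar> / 2"
  have "e > 0" using ne by (simp add: e_def)
  have "continuous_on S (D2 u v)" for u v using assms(2) by (simp add: D2_def numeral_2_eq_2)
  then have "isCont (D2 u v) x" for u v using assms by (meson continuous_on_eq_continuous_at)
  then have "\<exists>d>0. \<forall>y. dist y x < d \<longrightarrow> dist (D2 u v y) (D2 u v x) < e" for u v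
    using \<open>e > 0\<close> unfolding continuous_at by (metis (no_types, lifting) continuous_at_eps_delta \<open>isCont (D2 u v) x\<close>)
  then obtain d1 d2 where d: "d1 > 0" "d2 > 0"
    "\<And>y. dist y x < d1 \<Longrightarrow> dist (D2 u v y) (D2 u v x) < e"
    "\<And>y. dist y x < d2 \<Longrightarrow> dist (D2 v u y) (D2 v u x) < e"
    by meson
  obtain d3 where d3: "d3 > 0" "ball x d3 \<subseteq> S" using assms open_contains_ball by metis
  define d where "d = min d1 (min d2 d3)"
  \<comment> \<open>Keeps the parallelogram of side factor \<open>h\<close> within distance
    \<open>d\<close> of \<open>x\<close>; the summand 1 covers \<open>u = v = 0\<close>.\<close>
  define h where "h = d / (2 * (norm u + norm v + 1))"
  have pos: "norm u + norm v + 1 > 0" by (simp add: add_nonneg_pos)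
  have "d > 0" using d d3 by (simp add: d_def)
  then have "h > 0" using pos by (simp add: h_def)
  have hd: "h * (norm u + norm v) < d"
  proof -
    have "h * (norm u + norm v + 1) = d / 2" using pos by (simp add: h_def field_simps)
    then show ?thesis using \<open>h > 0\<close> \<open>d > 0\<close> by (simp add: algebra_simps)
  qed
  have near: "dist (x + s *\<^sub>R u + t *\<^sub>R v) x < d" if "0 \<le> s" "s \<le> h" "0 \<le> t" "t \<le> h" for s t
  proof -
    have "norm (s *\<^sub>R u + t *\<^sub>R v) \<le> s * norm u + t * norm v"
      using norm_triangle_ineq[of "s *\<^sub>R u" "t *\<^sub>R v"] that by simp
    also have "\<dots> \<le> h * norm u + h * norm v" using that by (intro add_mono mult_right_mono) auto
    finally show ?thesis using hd by (simp add: dist_norm algebra_simps)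
  qed
  have in_S: "x + s *\<^sub>R u + t *\<^sub>R v \<in> S" if "0 \<le> s" "s \<le> h" "0 \<le> t" "t \<le> h" for s t
    using near[OF that] d3 by (auto simp: d_def dist_commute)
  obtain s t where st: "0 < s" "s < h" "0 < t" "t < h"
    "f (x + h *\<^sub>R u + h *\<^sub>R v) - f (x + h *\<^sub>R u) - f (x + h *\<^sub>R v) + f x = h * h * D2 u v (x + s *\<^sub>R u + t *\<^sub>R v)"
    using second_difference_mean_value[OF assms(2) \<open>h > 0\<close> in_S] unfolding D2_def by blast
  have in_S': "x + s *\<^sub>R v + t *\<^sub>R u \<in> S" if "0 \<le> s" "s \<le> h" "0 \<le> t" "t \<le> h" for s t
    using in_S[of t s] that by (simp add: algebra_simps)
  obtain s' t' where st': "0 < s'" "s' < h" "0 < t'" "t' < h"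
    "f (x + h *\<^sub>R v + h *\<^sub>R u) - f (x + h *\<^sub>R v) - f (x + h *\<^sub>R u) + f x = h * h * D2 v u (x + s' *\<^sub>R v + t' *\<^sub>R u)"
    using second_difference_mean_value[OF assms(2) \<open>h > 0\<close> in_S'] unfolding D2_def by blast
  have "h * h * D2 u v (x + s *\<^sub>R u + t *\<^sub>R v) = h * h * D2 v u (x + s' *\<^sub>R v + t' *\<^sub>R u)"
    unfolding st(5)[symmetric] st'(5)[symmetric] by (simp add: algebra_simps)
  then have eq: "D2 u v (x + s *\<^sub>R u + t *\<^sub>R v) = D2 v u (x + t' *\<^sub>R u + s' *\<^sub>R v)"
    using \<open>h > 0\<close> by (simp add: algebra_simps)
  have "dist (D2 u v (x + s *\<^sub>R u + t *\<^sub>R v)) (D2 u v x) < e"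
    using near[of s t] st by (intro d) (auto simp: d_def)
  moreover have "dist (D2 v u (x + t' *\<^sub>R u + s' *\<^sub>R v)) (D2 v u x) < e"
    using near[of t' s'] st' by (intro d) (auto simp: d_def)
  ultimately show False unfolding eq e_def dist_real_def by (simp add: abs_if split: if_splits)
qed

lemma directional_derivative_eq:
  assumes "(f has_derivative f') (at x)"
  shows "directional_derivative f x u = f' u"
  using has_derivative_along_line[of f f' x 0 u] assms
  by (simp add: directional_derivative_def DERIV_imp_deriv)

text \<open>
  In the mixed coordinates \<open>(x, r)\<close>, with \<open>x\<close> from the first and the momentum \<open>r\<close> from the second
  chart, both coordinate expressions of a function are directly comparable; the second derivatives of
  \<open>\<tau>\<close> that appear cancel by symmetry.
\<close>

lemma coordinate_bracket_change:
  fixes B :: "'e::real_inner set" and \<tau> :: "'e \<Rightarrow> 'e"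
  defines "T \<equiv> \<lambda>x r. \<Sum>b\<in>B. (frechet_derivative \<tau> (at x) b \<bullet> r) *\<^sub>R b"
  assumes B: "orthonormal_basis B" and S: "open S" "x \<in> S" and tau: "smooth_on S \<tau>"
    and F: "(F has_derivative F') (at (x, T x r))" "(Fd has_derivative Fd') (at (\<tau> x, r))"
      "\<And>x r. x \<in> S \<Longrightarrow> F (x, T x r) = Fd (\<tau> x, r)"
    and G: "(G has_derivative G') (at (x, T x r))" "(Gd has_derivative Gd') (at (\<tau> x, r))"
      "\<And>x r. x \<in> S \<Longrightarrow> G (x, T x r) = Gd (\<tau> x, r)"
  shows "coordinate_bracket B F G (x, T x r) = coordinate_bracket B Fd Gd (\<tau> x, r)"
proof -
  let ?D = "\<lambda>x. frechet_derivative \<tau> (at x)"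
  \<comment> \<open>\<open>T x\<close> is the transpose of the derivative of \<open>\<tau>\<close>.
    \<open>K v b\<close> is the second derivative of \<open>\<tau> \<bullet> r\<close> at
    \<open>x\<close>, and at the same time the \<open>b\<close> component of the derivative of
    \<open>T x r\<close> in the base direction \<open>v\<close>.\<close>
  define K where "K v b = frechet_derivative (\<lambda>x. ?D x b) (at x) v \<bullet> r" for v b
  have D: "(\<tau> has_derivative ?D y) (at y)" if "y \<in> S" for y
    using smooth_on_has_derivative[OF tau that] .
  have D2: "((\<lambda>x. ?D x b) has_derivative frechet_derivative (\<lambda>x. ?D x b) (at x)) (at x)" for b
    using smooth_on_has_derivative[OF smooth_on_derivative[OF tau] S(2)] .
  have K_sym: "K a b = K b a" for a b
  proof -
    let ?f = "\<lambda>y. \<tau> y \<bullet> r"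
    have f: "frechet_derivative ?f (at y) b = ?D y b \<bullet> r" if "y \<in> S" for y b
      using frechet_derivative_at[OF has_derivative_inner_left[OF D[OF that]], of r] by metis
    have "((\<lambda>y. ?D y b \<bullet> r) has_derivative (\<lambda>v. K v b)) (at x)" for b
      unfolding K_def by (rule has_derivative_inner_left[OF D2])
    then have "((\<lambda>y. frechet_derivative ?f (at y) b) has_derivative (\<lambda>v. K v b)) (at x)" for b
      by (rule has_derivative_transform_within_open[OF _ S]) (simp add: f)
    then have K: "K v b = frechet_derivative (\<lambda>y. frechet_derivative ?f (at y) b) (at x) v" for v b
      using frechet_derivative_at by metis
    have "Ck_on 2 S ?f"
      by (intro smooth_on_Ck smooth_on_inner S tau smooth_on_const)
    from second_derivative_symmetric[OF S(1) this S(2)] show ?thesis by (simp add: K)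
  qed
  have T': "((\<lambda>y. (y, T y r)) has_derivative (\<lambda>v. (v, \<Sum>b\<in>B. K v b *\<^sub>R b))) (at x)"
    unfolding T_def K_def
    by (intro has_derivative_Pair has_derivative_ident has_derivative_sum has_derivative_scaleR_left
        has_derivative_inner_left D2)
  have T_lin: "((\<lambda>r. (x, T x r)) has_derivative (\<lambda>w. (0, T x w))) (at r)"
    unfolding T_def
    by (intro has_derivative_Pair has_derivative_const has_derivative_sum has_derivative_scaleR_left
        has_derivative_inner_right has_derivative_ident)
  \<comment> \<open>The compatibility of \<open>F\<close> and \<open>Fd\<close> is differentiated
    once in the base at fixed \<open>r\<close> and once in \<open>r\<close> at fixed
    \<open>x\<close>.\<close>
  have key: "Fd' (?D x v, 0) = F' (v, \<Sum>b\<in>B. K v b *\<^sub>R b) \<and> Fd' (0, w) = F' (0, T x w)"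
    if F1: "(F has_derivative F') (at (x, T x r))" and F2: "(Fd has_derivative Fd') (at (\<tau> x, r))"
      and F3: "\<And>x r. x \<in> S \<Longrightarrow> F (x, T x r) = Fd (\<tau> x, r)"
    for F F' Fd Fd' v w
  proof
    have "((\<lambda>y. F (y, T y r)) has_derivative (\<lambda>v. F' (v, \<Sum>b\<in>B. K v b *\<^sub>R b))) (at x)"
      by (rule has_derivative_compose[OF T' F1])
    then have "((\<lambda>y. Fd (\<tau> y, r)) has_derivative (\<lambda>v. F' (v, \<Sum>b\<in>B. K v b *\<^sub>R b))) (at x)"
      by (rule has_derivative_transform_within_open[OF _ S]) (simp add: F3)
    moreover have "((\<lambda>y. Fd (\<tau> y, r)) has_derivative (\<lambda>v. Fd' (?D x v, 0))) (at x)"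
      by (rule has_derivative_compose[OF has_derivative_Pair[OF D[OF S(2)] has_derivative_const] F2])
    ultimately show "Fd' (?D x v, 0) = F' (v, \<Sum>b\<in>B. K v b *\<^sub>R b)"
      by (rule fun_cong[OF has_derivative_unique[symmetric]])
    have "((\<lambda>r. Fd (\<tau> x, r)) has_derivative (\<lambda>w. F' (0, T x w))) (at r)"
      using has_derivative_compose[OF T_lin F1] by (simp add: F3[OF S(2)])
    moreover have "((\<lambda>r. Fd (\<tau> x, r)) has_derivative (\<lambda>w. Fd' (0, w))) (at r)"
      by (rule has_derivative_compose[OF has_derivative_Pair[OF has_derivative_const has_derivative_ident] F2])
    ultimately show "Fd' (0, w) = F' (0, T x w)"
      by (rule fun_cong[OF has_derivative_unique[symmetric]])
  qed
  \<comment> \<open>One half of the bracket. The double sum with \<open>K\<close> is the failure of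
    this half alone to be invariant; since \<open>K\<close> is symmetric, the sum does not change
    when \<open>F\<close> and \<open>G\<close> are exchanged and drops out of the
    difference.\<close>
  have expand: "(\<Sum>a\<in>B. Fd' (a, 0) * Gd' (0, a)) =
      (\<Sum>b\<in>B. F' (b, 0) * G' (0, b)) + (\<Sum>a\<in>B. \<Sum>b\<in>B. K a b * F' (0, b) * G' (0, a))"
    if F1: "(F has_derivative F') (at (x, T x r))" and F2: "(Fd has_derivative Fd') (at (\<tau> x, r))"
      and F3: "\<And>x r. x \<in> S \<Longrightarrow> F (x, T x r) = Fd (\<tau> x, r)"
      and G1: "(G has_derivative G') (at (x, T x r))" and G2: "(Gd has_derivative Gd') (at (\<tau> x, r))"
      and G3: "\<And>x r. x \<in> S \<Longrightarrow> G (x, T x r) = Gd (\<tau> x, r)"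
    for F F' Fd Fd' G G' Gd Gd'
  proof -
    note kF = key[OF F1 F2 F3] and kG = key[OF G1 G2 G3]
    have lin: "linear F'" "linear G'" "linear Fd'" using F1 F2 G1 has_derivative_linear by blast+
    have lin0: "linear (\<lambda>w. G' (0, w))" "linear (\<lambda>w. F' (0, w))" "linear (\<lambda>v. Fd' (v, 0))"
      using lin by (simp_all add: linear_iff flip: zero_prod_def)
        (metis add.right_neutral add_Pair scaleR_Pair scaleR_zero_right)+
    have "Gd' (0, a) = (\<Sum>b\<in>B. (?D x b \<bullet> a) * G' (0, b))" for a
      using kG unfolding T_def
      by (simp add: linear_sum[OF lin0(1)] linear_scale[OF lin0(1)])
    then have "(\<Sum>a\<in>B. Fd' (a, 0) * Gd' (0, a)) = (\<Sum>a\<in>B. \<Sum>b\<in>B. Fd' (a, 0) * ((?D x b \<bullet> a) * G' (0, b)))"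
      by (simp add: sum_distrib_left)
    also have "\<dots> = (\<Sum>b\<in>B. \<Sum>a\<in>B. Fd' (a, 0) * ((?D x b \<bullet> a) * G' (0, b)))"
      by (rule sum.swap)
    also have "\<dots> = (\<Sum>b\<in>B. Fd' (?D x b, 0) * G' (0, b))"
    proof (intro sum.cong refl)
      fix b
      have "Fd' (?D x b, 0) = (\<Sum>a\<in>B. (?D x b \<bullet> a) * Fd' (a, 0))"
        using orthonormal_basis_linear_expand[OF B lin0(3), of "?D x b"] by simp
      then show "(\<Sum>a\<in>B. Fd' (a, 0) * ((?D x b \<bullet> a) * G' (0, b))) = Fd' (?D x b, 0) * G' (0, b)"
        by (simp only: sum_distrib_right) (simp only: mult_ac)
    qed
    also have "\<dots> = (\<Sum>b\<in>B. (F' (b, 0) + (\<Sum>a\<in>B. K b a * F' (0, a))) * G' (0, b))"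
    proof (intro sum.cong refl arg_cong2[where f = "(*)"])
      fix b
      have "F' (b, \<Sum>a\<in>B. K b a *\<^sub>R a) = F' (b, 0) + F' (0, \<Sum>a\<in>B. K b a *\<^sub>R a)"
        by (simp flip: linear_add[OF lin(1)])
      then show "Fd' (?D x b, 0) = F' (b, 0) + (\<Sum>a\<in>B. K b a * F' (0, a))"
        using kF by (simp add: linear_sum[OF lin0(2)] linear_scale[OF lin0(2)])
    qed
    finally show ?thesis by (simp add: distrib_right sum.distrib sum_distrib_right)
  qed
  have "(\<Sum>a\<in>B. \<Sum>b\<in>B. K a b * F' (0, b) * G' (0, a)) = (\<Sum>b\<in>B. \<Sum>a\<in>B. K a b * F' (0, b) * G' (0, a))"
    by (rule sum.swap)
  also have "\<dots> = (\<Sum>a\<in>B. \<Sum>b\<in>B. K a b * G' (0, b) * F' (0, a))"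
    by (intro sum.cong refl) (simp add: K_sym)
  finally show ?thesis
    using expand[OF F G] expand[OF G F]
    by (simp add: coordinate_bracket_def directional_derivative_eq[OF F(1)] directional_derivative_eq[OF G(1)]
        directional_derivative_eq[OF F(2)] directional_derivative_eq[OF G(2)] sum_subtractf)
qed

section \<open>Representing functionals on a smooth family of subspaces\<close>

text \<open>Allows evaluation at a moving vector: linearity reduces it to the finitely many fixed
  vectors of \<open>B\<close>.\<close>

lemma smooth_on_linear_family:
  fixes B :: "'e::real_inner set" and l :: "'z::real_normed_vector \<Rightarrow> 'e \<Rightarrow> real"
  assumes "orthonormal_basis B" "open S" "\<And>z. z \<in> S \<Longrightarrow> linear (l z)" "\<And>u. smooth_on S (\<lambda>z. l z u)"
    "smooth_on S f"
  shows "smooth_on S (\<lambda>z. l z (f z))"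
proof (rule smooth_on_cong[OF assms(2)])
  show "(\<Sum>b\<in>B. (f z \<bullet> b) *\<^sub>R l z b) = l z (f z)" if "z \<in> S" for z
    using orthonormal_basis_linear_expand[OF assms(1) assms(3)[OF that]] by metis
  show "smooth_on S (\<lambda>z. \<Sum>b\<in>B. (f z \<bullet> b) *\<^sub>R l z b)"
    by (intro smooth_on_sum smooth_on_scaleR smooth_on_inner assms smooth_on_const)
qed

text \<open>
  Each induction step is a Gram-Schmidt step, which makes the smooth dependence evident without
  inverting a Gram matrix.
\<close>

lemma smooth_riesz:
  fixes B :: "'e::real_inner set" and g :: "'z::real_normed_vector \<Rightarrow> 'e \<Rightarrow> 'e \<Rightarrow> real" and \<omega> :: "nat \<Rightarrow> 'z \<Rightarrow> 'e"
  assumes B: "orthonormal_basis B" and S: "open S"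
    and lin: "\<And>z u. z \<in> S \<Longrightarrow> linear (g z u)" and sym: "\<And>z u w. z \<in> S \<Longrightarrow> g z u w = g z w u"
    and pos: "\<And>z u. z \<in> S \<Longrightarrow> u \<noteq> 0 \<Longrightarrow> g z u u > 0"
    and g: "\<And>u w. smooth_on S (\<lambda>z. g z u w)"
    and om: "\<And>i. i < k \<Longrightarrow> smooth_on S (\<omega> i)"
    and ind: "\<And>i z. i < k \<Longrightarrow> z \<in> S \<Longrightarrow> \<omega> i z \<notin> span ((\<lambda>j. \<omega> j z) ` {..<i})"
    and l: "\<And>z. z \<in> S \<Longrightarrow> linear (l z)" "\<And>u. smooth_on S (\<lambda>z. l z u)"
  shows "\<exists>R. smooth_on S R \<and> (\<forall>z\<in>S. R z \<in> span ((\<lambda>j. \<omega> j z) ` {..<k}) \<and>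
    (\<forall>w\<in>span ((\<lambda>j. \<omega> j z) ` {..<k}). g z (R z) w = l z w))"
  using om ind l
proof (induction k arbitrary: l)
  case 0
  then show ?case by (intro exI[of _ "\<lambda>_. 0"]) (auto simp: smooth_on_const linear_0 lin)
next
  case (Suc k)
  let ?W = "\<lambda>z. span ((\<lambda>j. \<omega> j z) ` {..<k})"
  have IH: "\<exists>R. smooth_on S R \<and> (\<forall>z\<in>S. R z \<in> ?W z \<and> (\<forall>w\<in>?W z. g z (R z) w = l z w))"
    if "\<And>z. z \<in> S \<Longrightarrow> linear (l z)" "\<And>u. smooth_on S (\<lambda>z. l z u)" for l
    by (rule Suc.IH) (use Suc.prems(1,2) that in auto)
  have g1: "linear (\<lambda>u. g z u w)" if "z \<in> S" for z w
    using lin[OF that, of w] by (simp add: sym[OF that, of _ w])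
  have g_smooth: "smooth_on S (\<lambda>z. g z (a z) (b z))" if "smooth_on S a" "smooth_on S b" for a b
    by (intro smooth_on_linear_family[OF B S lin _ that(2)] smooth_on_linear_family[OF B S g1 g that(1)])
  \<comment> \<open>Projection of the new frame vector to the span of the earlier ones, from the
    induction hypothesis for the functional \<open>g z (\<omega> k z)\<close>. The remainder
    \<open>e z\<close> below is nonzero by the independence assumption.\<close>
  obtain P where P: "smooth_on S P" "\<And>z. z \<in> S \<Longrightarrow> P z \<in> ?W z"
    "\<And>z w. z \<in> S \<Longrightarrow> w \<in> ?W z \<Longrightarrow> g z (P z) w = g z (\<omega> k z) w"
    using IH[of "\<lambda>z. g z (\<omega> k z)"] lin smooth_on_linear_family[OF B S g1 g Suc.prems(1)[of k]] by auto
  obtain R where R: "smooth_on S R" "\<And>z. z \<in> S \<Longrightarrow> R z \<in> ?W z"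
    "\<And>z w. z \<in> S \<Longrightarrow> w \<in> ?W z \<Longrightarrow> g z (R z) w = l z w"
    using IH[OF Suc.prems(3,4)] by auto
  define e where "e z = \<omega> k z - P z" for z
  have e: "smooth_on S e" unfolding e_def by (intro smooth_on_diff S Suc.prems P) simp
  have e_nz: "g z (e z) (e z) > 0" if "z \<in> S" for z
  proof -
    have "e z \<noteq> 0" using Suc.prems(2)[OF _ that, of k] P(2)[OF that] by (metis e_def eq_iff_diff_eq_0 lessI)
    then show ?thesis by (rule pos[OF that])
  qed
  then have e_nz': "g z (e z) (e z) \<noteq> 0" if "z \<in> S" for z
    using that by (metis less_irrefl)
  have e_orth: "g z (e z) w = 0" if "z \<in> S" "w \<in> ?W z" for z w
    using P(3)[OF that] linear_diff[OF g1[OF that(1)]] by (simp add: e_def)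
  \<comment> \<open>\<open>e z\<close> is orthogonal to \<open>?W z\<close>, so adding a multiple of
    it keeps the values on \<open>?W z\<close>; the coefficient is the one that produces the value
    \<open>l z (e z)\<close> on \<open>e z\<close>.\<close>
  define R' where "R' z = R z + ((l z (e z) - g z (R z) (e z)) * inverse (g z (e z) (e z))) *\<^sub>R e z" for z
  have "smooth_on S R'"
    unfolding R'_def
    by (intro smooth_on_add smooth_on_scaleR smooth_on_mult smooth_on_diff smooth_on_inverse S R e g_smooth
        smooth_on_linear_family[OF B S Suc.prems(3,4)]) (simp_all add: e_nz')
  moreover have "R' z \<in> span ((\<lambda>j. \<omega> j z) ` {..<Suc k}) \<and>
    (\<forall>w\<in>span ((\<lambda>j. \<omega> j z) ` {..<Suc k}). g z (R' z) w = l z w)" if z: "z \<in> S" for z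
  proof -
    have sub: "?W z \<subseteq> span ((\<lambda>j. \<omega> j z) ` {..<Suc k})"
      by (intro span_mono) auto
    have "\<omega> k z \<in> span ((\<lambda>j. \<omega> j z) ` {..<Suc k})" by (intro span_base) auto
    then have "e z \<in> span ((\<lambda>j. \<omega> j z) ` {..<Suc k})" "R z \<in> span ((\<lambda>j. \<omega> j z) ` {..<Suc k})"
      using sub P(2)[OF z] R(2)[OF z] by (auto simp: e_def intro: span_diff)
    then have "R' z \<in> span ((\<lambda>j. \<omega> j z) ` {..<Suc k})"
      unfolding R'_def by (intro span_add span_scale)
    moreover have "g z (R' z) w = l z w" if w: "w \<in> span ((\<lambda>j. \<omega> j z) ` {..<Suc k})" for w
    proof -
      have "w \<in> span (insert (\<omega> k z) ((\<lambda>j. \<omega> j z) ` {..<k}))"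
        using w by (simp add: lessThan_Suc)
      then obtain c where c: "w - c *\<^sub>R \<omega> k z \<in> ?W z" by (meson span_breakdown_eq)
      define w' where "w' = w - c *\<^sub>R e z"
      have "w' = (w - c *\<^sub>R \<omega> k z) + c *\<^sub>R P z" by (simp add: w'_def e_def algebra_simps)
      then have w': "w' \<in> ?W z" using c P(2)[OF z] by (simp add: span_add span_scale)
      have w_eq: "w = w' + c *\<^sub>R e z" by (simp add: w'_def)
      have R'_eq: "g z (R' z) u = g z (R z) u + (l z (e z) - g z (R z) (e z)) * inverse (g z (e z) (e z)) * g z (e z) u" for u
        unfolding R'_def by (simp add: linear_add[OF g1[OF z]] linear_scale[OF g1[OF z]])
      have "g z (R' z) w' = l z w'" by (simp add: R'_eq e_orth[OF z w'] R(3)[OF z w'])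
      moreover have "g z (R' z) (e z) = l z (e z)"
        using e_nz'[OF z] by (simp add: R'_eq mult.assoc)
      ultimately show ?thesis
        by (simp add: w_eq linear_add[OF lin[OF z]] linear_scale[OF lin[OF z]]
            linear_add[OF Suc.prems(3)[OF z]] linear_scale[OF Suc.prems(3)[OF z]])
    qed
    ultimately show ?thesis by blast
  qed
  ultimately show ?case by blast
qed

section \<open>Coordinates on the tangent and cotangent bundles\<close>

text \<open>The covector with momentum \<open>p\<close> in the chart \<open>c\<close>, inverse to
  \<open>momentum\<close> below. The value 0 off the tangent space is dictated by
  \<open>cotangent_space\<close>.\<close>

definition coord_covec :: "('q, 'e::real_inner) chart set \<Rightarrow> ('q, 'e) chart \<Rightarrow> 'q \<Rightarrow> 'e \<Rightarrow> ('q, 'e) covec" where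
  "coord_covec A c q p = (\<lambda>v. if v \<in> tangent_space A q then p \<bullet> v c else 0)"

text \<open>The Riesz vector of a covector in the coordinates of \<open>c\<close>, for the inner
  product of the model space; it is the second component of \<open>cotangent_chart\<close>.\<close>

definition momentum :: "'e::real_inner set \<Rightarrow> ('q, 'e) chart set \<Rightarrow> ('q, 'e) chart \<Rightarrow> 'q \<Rightarrow> ('q, 'e) covec \<Rightarrow> 'e" where
  "momentum B A c q a = (\<Sum>b\<in>B. a (coord_tvec A c q b) *\<^sub>R b)"

locale smooth_atlas =
  fixes B :: "'e::real_inner set" and X :: "'q topology" and A :: "('q, 'e) chart set"
  assumes onb: "orthonormal_basis B" and manifold: "smooth_manifold X A"
begin

lemma points_eq: "points A = topspace X"
  using manifold by (simp add: smooth_manifold_def)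

lemma charts_atD: "c \<in> charts_at A q \<Longrightarrow> c \<in> A" "c \<in> charts_at A q \<Longrightarrow> q \<in> fst c"
  by (auto simp: charts_at_def)

lemma charts_atI: "c \<in> A \<Longrightarrow> q \<in> fst c \<Longrightarrow> c \<in> charts_at A q"
  by (auto simp: charts_at_def)

lemma charts_at_points: "c \<in> charts_at A q \<Longrightarrow> q \<in> points A"
  by (auto simp: charts_at_def points_def)

lemma obtain_chart:
  assumes "q \<in> points A"
  obtains c where "c \<in> charts_at A q"
  using assms by (auto simp: charts_at_def points_def)

context
  fixes c assumes c: "c \<in> A"
begin

lemma openin_chart: "openin X (fst c)"
  and open_chart_image: "open (snd c ` fst c)"
  and homeomorphic_chart: "homeomorphic_map (subtopology X (fst c)) (top_of_set (snd c ` fst c)) (snd c)"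
  using manifold c by (auto simp: smooth_manifold_def)

lemma topspace_chart: "topspace (subtopology X (fst c)) = fst c"
  using openin_subset[OF openin_chart] by auto

lemma inj_on_chart: "inj_on (snd c) (fst c)"
  using homeomorphic_imp_injective_map[OF homeomorphic_chart] by (simp only: topspace_chart)

lemma open_chart_overlap:
  assumes "openin X U"
  shows "open (snd c ` (fst c \<inter> U))"
proof -
  have "openin (subtopology X (fst c)) (fst c \<inter> U)"
    using assms by (auto simp: openin_subtopology_alt)
  then have "openin (top_of_set (snd c ` fst c)) (snd c ` (fst c \<inter> U))"
    using homeomorphic_imp_open_map[OF homeomorphic_chart] by (auto simp: open_map_def)
  then show ?thesis using open_chart_image openin_open_trans by blast
qed

lemma chart_inv_chart [simp]: "q \<in> fst c \<Longrightarrow> chart_inv c (snd c q) = q"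
  by (simp add: chart_inv_def inj_on_chart)

lemma chart_inv_in: "x \<in> snd c ` fst c \<Longrightarrow> chart_inv c x \<in> fst c"
  by (simp add: chart_inv_def inv_into_into)

lemma chart_chart_inv [simp]: "x \<in> snd c ` fst c \<Longrightarrow> snd c (chart_inv c x) = x"
  by (simp add: chart_inv_def f_inv_into_f)

lemma chart_inv_charts_at: "x \<in> snd c ` fst c \<Longrightarrow> c \<in> charts_at A (chart_inv c x)"
  by (intro charts_atI c chart_inv_in)

end

abbreviation "dtrans c d q \<equiv> frechet_derivative (transition c d) (at (snd c q))"

lemma open_overlap: "c \<in> A \<Longrightarrow> d \<in> A \<Longrightarrow> open (snd c ` (fst c \<inter> fst d))"
  by (intro open_chart_overlap openin_chart)

lemma smooth_transition: "c \<in> A \<Longrightarrow> d \<in> A \<Longrightarrow> smooth_on (snd c ` (fst c \<inter> fst d)) (transition c d)"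
  using manifold by (simp add: smooth_manifold_def)

lemma transition_chart [simp]: "c \<in> A \<Longrightarrow> q \<in> fst c \<Longrightarrow> transition c d (snd c q) = snd d q"
  by (simp add: transition_def)

lemma has_derivative_transition:
  assumes "c \<in> charts_at A q" "d \<in> charts_at A q"
  shows "(transition c d has_derivative dtrans c d q) (at (snd c q))"
  by (rule smooth_on_has_derivative[OF smooth_transition]) (use assms charts_atD in auto)

lemma linear_dtrans:
  assumes "c \<in> charts_at A q" "d \<in> charts_at A q"
  shows "linear (dtrans c d q)"
  using has_derivative_transition[OF assms] by (rule has_derivative_linear)

text \<open>Chain rule on the triple overlap. This cocycle identity is what makes
  \<open>coord_tvec\<close> a tangent vector.\<close>

lemma dtrans_dtrans:
  assumes "c \<in> charts_at A q" "d \<in> charts_at A q" "e \<in> charts_at A q"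
  shows "dtrans d e q (dtrans c d q u) = dtrans c e q u"
proof -
  let ?S = "snd c ` (fst c \<inter> (fst d \<inter> fst e))"
  note c = charts_atD[OF assms(1)] and d = charts_atD[OF assms(2)] and e = charts_atD[OF assms(3)]
  have "((\<lambda>x. transition d e (transition c d x)) has_derivative (\<lambda>u. dtrans d e q (dtrans c d q u))) (at (snd c q))"
    by (rule has_derivative_compose[OF has_derivative_transition[OF assms(1,2)]])
      (use has_derivative_transition[OF assms(2,3)] c in simp)
  then have "(transition c e has_derivative (\<lambda>u. dtrans d e q (dtrans c d q u))) (at (snd c q))"
  proof (rule has_derivative_transform_within_open)
    show "open ?S" using c d e by (intro open_chart_overlap openin_Int openin_chart)
    show "snd c q \<in> ?S" using c d e by auto
    show "transition d e (transition c d x) = transition c e x" if "x \<in> ?S" for x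
      using that c d e by auto
  qed
  then show ?thesis
    using fun_cong[OF has_derivative_unique[OF _ has_derivative_transition[OF assms(1,3)]]] by blast
qed

lemma dtrans_self:
  assumes "c \<in> charts_at A q"
  shows "dtrans c c q u = u"
proof -
  note c = charts_atD[OF assms]
  have "(transition c c has_derivative (\<lambda>u. u)) (at (snd c q))"
    by (rule has_derivative_transform_within_open[OF has_derivative_ident open_chart_image[OF c(1)]])
      (use c in auto)
  then show ?thesis
    using fun_cong[OF has_derivative_unique[OF has_derivative_transition[OF assms assms]]] by blast
qed

lemma coord_tvec_chart: "d \<in> charts_at A q \<Longrightarrow> coord_tvec A c q u d = dtrans c d q u"
  by (simp add: coord_tvec_def)

lemma tangent_space_component:
  "v \<in> tangent_space A q \<Longrightarrow> c \<in> charts_at A q \<Longrightarrow> d \<in> charts_at A q \<Longrightarrow> v d = dtrans c d q (v c)"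
  unfolding tangent_space_def by blast

context
  fixes c q assumes c: "c \<in> charts_at A q"
begin

lemma coord_tvec_self [simp]: "coord_tvec A c q u c = u"
  by (simp add: coord_tvec_chart c dtrans_self)

lemma coord_tvec_in [simp]: "coord_tvec A c q u \<in> tangent_space A q"
  unfolding tangent_space_def by (auto simp: coord_tvec_chart dtrans_dtrans c) (simp add: coord_tvec_def)

lemma coord_tvec_component:
  assumes "v \<in> tangent_space A q"
  shows "coord_tvec A c q (v c) = v"
proof
  fix d
  show "coord_tvec A c q (v c) d = v d"
  proof (cases "d \<in> charts_at A q")
    case True
    then show ?thesis using tangent_space_component[OF assms c True] by (simp add: coord_tvec_chart)
  next
    case False
    then have "v d = 0" using assms unfolding tangent_space_def by blast
    then show ?thesis using False by (simp add: coord_tvec_def)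
  qed
qed

lemma coord_tvec_add: "coord_tvec A c q (u + w) = (\<lambda>d. coord_tvec A c q u d + coord_tvec A c q w d)"
  using linear_add[OF linear_dtrans[OF c]] by (auto simp: coord_tvec_def)

lemma coord_tvec_scale: "coord_tvec A c q (s *\<^sub>R u) = (\<lambda>d. s *\<^sub>R coord_tvec A c q u d)"
  using linear_scale[OF linear_dtrans[OF c]] by (auto simp: coord_tvec_def)

lemma tangent_linear_coord:
  assumes "tangent_linear A q f"
  shows "linear (\<lambda>u. f (coord_tvec A c q u))"
  using assms by (auto simp: tangent_linear_def linear_iff coord_tvec_add coord_tvec_scale)

lemma tangent_add: "v \<in> tangent_space A q \<Longrightarrow> w \<in> tangent_space A q \<Longrightarrow> (\<lambda>d. v d + w d) \<in> tangent_space A q"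
  using coord_tvec_in[of "v c + w c"] by (simp add: coord_tvec_add coord_tvec_component)

lemma tangent_scale: "v \<in> tangent_space A q \<Longrightarrow> (\<lambda>d. s *\<^sub>R v d) \<in> tangent_space A q"
  using coord_tvec_in[of "s *\<^sub>R v c"] by (simp add: coord_tvec_scale coord_tvec_component)

lemma coord_covec_in [simp]: "coord_covec A c q p \<in> cotangent_space A q"
  by (auto simp: cotangent_space_def tangent_linear_def coord_covec_def tangent_add tangent_scale inner_add_right)

lemma coord_covec_coord_tvec [simp]: "coord_covec A c q p (coord_tvec A c q u) = p \<bullet> u"
  by (simp add: coord_covec_def)

lemma momentum_coord_covec [simp]: "momentum B A c q (coord_covec A c q p) = p"
  using orthonormal_basis_expand[OF onb, of p] by (simp add: momentum_def)

lemma inner_momentum: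
  assumes "a \<in> cotangent_space A q"
  shows "momentum B A c q a \<bullet> u = a (coord_tvec A c q u)"
proof -
  have "tangent_linear A q a" using assms by (simp add: cotangent_space_def)
  from orthonormal_basis_linear_expand[OF onb tangent_linear_coord[OF this], of u]
  show ?thesis by (simp add: momentum_def inner_sum_left inner_commute[of u] mult.commute)
qed

lemma coord_covec_momentum:
  assumes "a \<in> cotangent_space A q"
  shows "coord_covec A c q (momentum B A c q a) = a"
proof
  fix v
  show "coord_covec A c q (momentum B A c q a) v = a v"
    using assms inner_momentum[OF assms, of "v c"] coord_tvec_component[of v]
    by (auto simp: coord_covec_def cotangent_space_def)
qed

lemma coord_covec_lin:
  "coord_covec A c q (s *\<^sub>R p + t *\<^sub>R r) = (\<lambda>v. s * coord_covec A c q p v + t * coord_covec A c q r v)"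
  by (auto simp: coord_covec_def inner_add_left)

lemma coord_covec_sum:
  "coord_covec A c q (\<Sum>i\<in>I. r i *\<^sub>R p i) = (\<lambda>v. \<Sum>i\<in>I. r i * coord_covec A c q (p i) v)"
  by (auto simp: coord_covec_def inner_sum_left)

lemma coord_covec_inject: "coord_covec A c q p = coord_covec A c q r \<longleftrightarrow> p = r"
  by (metis momentum_coord_covec)

text \<open>Tangent components transform by the derivative of the transition map, hence momenta by
  its transpose in the opposite direction: this is the map \<open>T\<close> of
  \<open>coordinate_bracket_change\<close>.\<close>

lemma coord_covec_change:
  assumes d: "d \<in> charts_at A q"
  shows "coord_covec A d q r = coord_covec A c q (\<Sum>b\<in>B. (dtrans c d q b \<bullet> r) *\<^sub>R b)"
proof
  fix v
  have "r \<bullet> v d = (\<Sum>b\<in>B. (dtrans c d q b \<bullet> r) *\<^sub>R b) \<bullet> v c" if v: "v \<in> tangent_space A q"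
  proof -
    have "v d = (\<Sum>b\<in>B. (v c \<bullet> b) *\<^sub>R dtrans c d q b)"
      unfolding tangent_space_component[OF v c d]
      by (rule orthonormal_basis_linear_expand[OF onb linear_dtrans[OF c d]])
    then show ?thesis by (simp add: inner_sum_right inner_sum_left inner_commute mult.commute)
  qed
  then show "coord_covec A d q r v = coord_covec A c q (\<Sum>b\<in>B. (dtrans c d q b \<bullet> r) *\<^sub>R b) v"
    by (simp add: coord_covec_def)
qed

end

section \<open>Canonical charts of the cotangent bundle\<close>

lemma cotangent_chart_apply: "snd (cotangent_chart B A c) (q, a) = (snd c q, momentum B A c q a)"
  by (simp add: cotangent_chart_def momentum_def)

lemma cotangent_chart_dom: "fst (cotangent_chart B A c) = {\<alpha> \<in> cotangent_bundle A. fst \<alpha> \<in> fst c}"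
  by (simp add: cotangent_chart_def)

lemma coord_covec_bundle: "c \<in> charts_at A q \<Longrightarrow> (q, coord_covec A c q p) \<in> cotangent_bundle A"
  by (simp add: cotangent_bundle_def charts_at_points)

text \<open>Brings a covector into the form in which the coordinate statements below are
  phrased.\<close>

lemma cotangent_bundle_cases:
  assumes "\<alpha> \<in> cotangent_bundle A" "c \<in> A" "fst \<alpha> \<in> fst c"
  obtains x p where "x \<in> snd c ` fst c" "x = snd c (fst \<alpha>)" "\<alpha> = (chart_inv c x, coord_covec A c (chart_inv c x) p)"
proof (rule that[OF _ refl])
  show "snd c (fst \<alpha>) \<in> snd c ` fst c" using assms by simp
  show "\<alpha> = (chart_inv c (snd c (fst \<alpha>)),
      coord_covec A c (chart_inv c (snd c (fst \<alpha>))) (momentum B A c (fst \<alpha>) (snd \<alpha>)))"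
    using assms by (auto simp: cotangent_bundle_def coord_covec_momentum charts_atI intro!: prod_eqI)
qed

context
  fixes c assumes c: "c \<in> A"
begin

lemma inj_on_cotangent_chart: "inj_on (snd (cotangent_chart B A c)) (fst (cotangent_chart B A c))"
proof (rule inj_onI)
  fix \<alpha> \<beta>
  assume *: "\<alpha> \<in> fst (cotangent_chart B A c)" "\<beta> \<in> fst (cotangent_chart B A c)"
    and eq: "snd (cotangent_chart B A c) \<alpha> = snd (cotangent_chart B A c) \<beta>"
  obtain q a q' a' where ab: "\<alpha> = (q, a)" "\<beta> = (q', a')" by fastforce
  have "q \<in> fst c" "q' \<in> fst c" using * by (auto simp: ab cotangent_chart_dom)
  moreover have "snd c q = snd c q'" using eq by (simp add: ab cotangent_chart_apply)
  ultimately have "q' = q" using inj_on_chart[OF c] by (auto dest: inj_onD)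
  then show "\<alpha> = \<beta>"
    using * eq coord_covec_momentum[of c q] c
    by (auto simp: ab cotangent_chart_apply cotangent_chart_dom cotangent_bundle_def charts_at_def) metis
qed

lemma cotangent_chart_coord:
  assumes "x \<in> snd c ` fst c"
  shows "snd (cotangent_chart B A c) (chart_inv c x, coord_covec A c (chart_inv c x) p) = (x, p)"
    and "(chart_inv c x, coord_covec A c (chart_inv c x) p) \<in> fst (cotangent_chart B A c)"
  using assms c chart_inv_charts_at[OF c assms]
  by (simp_all add: cotangent_chart_apply cotangent_chart_dom coord_covec_bundle chart_inv_in)

lemma chart_inv_cotangent_chart:
  assumes "x \<in> snd c ` fst c"
  shows "chart_inv (cotangent_chart B A c) (x, p) = (chart_inv c x, coord_covec A c (chart_inv c x) p)"
  using inv_into_f_f[OF inj_on_cotangent_chart cotangent_chart_coord(2)[OF assms]]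
  by (simp add: chart_inv_def cotangent_chart_coord(1)[OF assms, unfolded chart_inv_def])

text \<open>\<open>U\<close> is left free: a second chart domain gives the overlap of canonical
  charts, \<open>UNIV\<close> the whole image. Every momentum is attained because
  \<open>coord_covec\<close> provides a preimage.\<close>

lemma cotangent_chart_image:
  "snd (cotangent_chart B A c) ` {\<alpha> \<in> cotangent_bundle A. fst \<alpha> \<in> fst c \<inter> U} = snd c ` (fst c \<inter> U) \<times> UNIV"
proof (intro subset_antisym subsetI)
  fix z assume "z \<in> snd (cotangent_chart B A c) ` {\<alpha> \<in> cotangent_bundle A. fst \<alpha> \<in> fst c \<inter> U}"
  then show "z \<in> snd c ` (fst c \<inter> U) \<times> UNIV"
    by (auto simp: cotangent_chart_apply)
next
  fix z assume "z \<in> snd c ` (fst c \<inter> U) \<times> (UNIV :: 'e set)"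
  then obtain q p where z: "z = (snd c q, p)" "q \<in> fst c" "q \<in> U" by auto
  then have "z = snd (cotangent_chart B A c) (q, coord_covec A c q p)"
    "(q, coord_covec A c q p) \<in> cotangent_bundle A"
    using c by (auto simp: cotangent_chart_apply charts_atI coord_covec_bundle)
  then show "z \<in> snd (cotangent_chart B A c) ` {\<alpha> \<in> cotangent_bundle A. fst \<alpha> \<in> fst c \<inter> U}"
    using z by (intro image_eqI[of _ _ "(q, coord_covec A c q p)"]) auto
qed

end

lemma points_cotangent_atlas: "points (cotangent_atlas B A) = cotangent_bundle A"
  by (auto simp: points_def cotangent_atlas_def cotangent_chart_dom cotangent_bundle_def)

lemma charts_at_cotangent_atlas:
  assumes "\<alpha> \<in> cotangent_bundle A"
  shows "charts_at (cotangent_atlas B A) \<alpha> = cotangent_chart B A ` charts_at A (fst \<alpha>)"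
  using assms by (auto simp: charts_at_def cotangent_atlas_def cotangent_chart_dom)

section \<open>Simple functions in coordinates\<close>

definition metric_coords :: "('q \<Rightarrow> ('q, 'e) tvec \<Rightarrow> ('q, 'e) tvec \<Rightarrow> real) \<Rightarrow> ('q, 'e) chart \<Rightarrow> 'e \<Rightarrow> 'e \<Rightarrow> 'e \<Rightarrow> real"
  where "metric_coords \<rho> c x u w =
    \<rho> (chart_inv c x) (coord_tvec A c (chart_inv c x) u) (coord_tvec A c (chart_inv c x) w)"

text \<open>\<open>s (x, p)\<close> is the inverse metric applied to \<open>p\<close>. Joint
  smoothness comes from \<open>smooth_riesz\<close>, with an enumeration of \<open>B\<close> as
  constant frame and the momentum treated as a parameter, instead of from inverting a
  matrix.\<close>

lemma sharp_coordinates: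
  assumes rho: "riemannian_metric A \<rho>" and c: "c \<in> A"
  shows "\<exists>s. smooth_on (snd c ` fst c \<times> UNIV) s \<and> (\<forall>x\<in>snd c ` fst c.
     (\<forall>p. sharp A \<rho> (chart_inv c x, coord_covec A c (chart_inv c x) p) =
       (chart_inv c x, coord_tvec A c (chart_inv c x) (s (x, p)))) \<and>
     linear (\<lambda>p. s (x, p)) \<and> (\<forall>p r. p \<bullet> s (x, r) = r \<bullet> s (x, p)) \<and>
     (\<forall>p. p \<noteq> 0 \<longrightarrow> p \<bullet> s (x, p) > 0))"
proof -
  let ?M = "snd c ` fst c"
  let ?g = "metric_coords \<rho> c"
  have lin: "linear (?g x u)" and sym: "?g x u w = ?g x w u" and pos: "u \<noteq> 0 \<Longrightarrow> ?g x u u > 0"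
    if x: "x \<in> ?M" for x u w
  proof -
    note q = chart_inv_charts_at[OF c x]
    note rho_q = rho[unfolded riemannian_metric_def, THEN conjunct1, rule_format, OF charts_at_points[OF q]]
    show "linear (?g x u)"
      unfolding metric_coords_def using rho_q q by (intro tangent_linear_coord) auto
    show "?g x u w = ?g x w u" unfolding metric_coords_def using rho_q q by auto
    assume "u \<noteq> 0"
    then have "coord_tvec A c (chart_inv c x) u \<noteq> (\<lambda>_. 0)"
      using coord_tvec_self[OF q, of u] by metis
    then show "?g x u u > 0" unfolding metric_coords_def using rho_q q by auto
  qed
  have smooth: "smooth_on ?M (\<lambda>x. ?g x u w)" for u w
    using rho c by (simp add: riemannian_metric_def metric_coords_def Let_def)
  have opn: "open (?M \<times> (UNIV :: 'e set))" by (intro open_Times open_UNIV open_chart_image c)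
  have finB: "finite B" using onb by (simp add: orthonormal_basis_def)
  obtain h where h: "bij_betw h {..<card B} B"
    using ex_bij_betw_nat_finite[OF finB] by (auto simp: atLeast0LessThan)
  have hB: "h ` {..<card B} = B" using h by (simp add: bij_betw_def)
  have indB: "independent B"
    using onb by (intro pairwise_orthogonal_independent)
      (auto simp: orthonormal_basis_def pairwise_def orthogonal_def, metis inner_zero_left zero_neq_one)
  \<comment> \<open>The triangular form of independence that \<open>smooth_riesz\<close> asks
    for.\<close>
  have ind: "h i \<notin> span (h ` {..<i})" if i: "i < card B" for i
  proof -
    have "h ` {..<i} \<subseteq> B - {h i}"
    proof
      fix b assume "b \<in> h ` {..<i}"
      then obtain j where j: "b = h j" "j < i" by auto
      then have "h j \<in> B" "h j \<noteq> h i" using h i by (auto simp: bij_betw_def inj_on_def)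
      then show "b \<in> B - {h i}" using j by simp
    qed
    moreover have "h i \<in> B" using hB i by auto
    ultimately show ?thesis using indB span_mono by (metis dependent_def subsetD)
  qed
  have "\<exists>R. smooth_on (?M \<times> UNIV) R \<and> (\<forall>z\<in>?M \<times> UNIV. R z \<in> span (h ` {..<card B}) \<and>
      (\<forall>w\<in>span (h ` {..<card B}). ?g (fst z) (R z) w = snd z \<bullet> w))"
  proof (rule smooth_riesz[OF onb opn])
    show "smooth_on (?M \<times> UNIV) (\<lambda>z::'e \<times> 'e. ?g (fst z) u w)" for u w
      by (rule smooth_on_compose[where g = fst and f = "\<lambda>x. ?g x u w", OF onb opn open_chart_image[OF c] _ smooth])
        (auto intro: smooth_on_bounded_linear opn bounded_linear_fst)
    show "smooth_on (?M \<times> UNIV) (\<lambda>z::'e \<times> 'e. snd z \<bullet> u)" for u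
      by (intro smooth_on_inner opn smooth_on_const smooth_on_bounded_linear bounded_linear_snd)
  qed (use lin sym pos ind in \<open>auto simp: smooth_on_const linear_iff inner_add_right\<close>)
  moreover have "span (h ` {..<card B}) = UNIV" using onb by (simp add: hB orthonormal_basis_def)
  ultimately obtain s where s: "smooth_on (?M \<times> UNIV) s" "\<And>x p w. x \<in> ?M \<Longrightarrow> ?g x (s (x, p)) w = p \<bullet> w"
    by force
  \<comment> \<open>Definiteness makes the representing vector unique; this evaluates the
    \<open>THE\<close> in \<open>sharp\<close> and yields linearity of \<open>s\<close> in the
    momentum.\<close>
  have uniq: "u = u'" if x: "x \<in> ?M" and "\<And>w. ?g x u w = ?g x u' w" for x u u'
  proof (rule ccontr)
    assume "u \<noteq> u'"
    then have "?g x (u - u') (u - u') > 0" using pos[OF x] by simp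
    moreover have "?g x (u - u') w = 0" for w
      using that(2)[of w] sym[OF x, of _ w] linear_diff[OF lin[OF x, of w], of u u'] by simp
    ultimately show False by simp
  qed
  have g_lin1: "linear (\<lambda>u. ?g x u w)" if "x \<in> ?M" for x w
    using lin[OF that, of w] by (simp add: sym[OF that, of _ w])
  show ?thesis
  proof (intro exI[of _ s] conjI s(1) ballI allI impI)
    fix x p assume x: "x \<in> ?M"
    let ?q = "chart_inv c x"
    note q = chart_inv_charts_at[OF c x]
    note rho_q = rho[unfolded riemannian_metric_def, THEN conjunct1, rule_format, OF charts_at_points[OF q]]
    have "(THE v. v \<in> tangent_space A ?q \<and> (\<forall>w\<in>tangent_space A ?q. \<rho> ?q v w = coord_covec A c ?q p w)) =
        coord_tvec A c ?q (s (x, p))"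
    proof (rule the_equality)
      show "coord_tvec A c ?q (s (x, p)) \<in> tangent_space A ?q \<and>
        (\<forall>w\<in>tangent_space A ?q. \<rho> ?q (coord_tvec A c ?q (s (x, p))) w = coord_covec A c ?q p w)"
      proof (intro conjI ballI)
        fix w assume w: "w \<in> tangent_space A ?q"
        then show "\<rho> ?q (coord_tvec A c ?q (s (x, p))) w = coord_covec A c ?q p w"
          using s(2)[OF x, of p "w c"] coord_tvec_component[OF q w]
          by (simp add: metric_coords_def coord_covec_def)
      qed (simp add: q)
      fix v assume v: "v \<in> tangent_space A ?q \<and> (\<forall>w\<in>tangent_space A ?q. \<rho> ?q v w = coord_covec A c ?q p w)"
      then have "?g x (v c) w = p \<bullet> w" for w
        using coord_tvec_component[OF q, of v] q by (simp add: metric_coords_def)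
      then have "v c = s (x, p)" using s(2)[OF x] by (intro uniq[OF x]) simp
      then show "v = coord_tvec A c ?q (s (x, p))" using coord_tvec_component[OF q, of v] v by simp
    qed
    then show "sharp A \<rho> (?q, coord_covec A c ?q p) = (?q, coord_tvec A c ?q (s (x, p)))"
      by (simp add: sharp_def)
  next
    fix x assume x: "x \<in> ?M"
    show "linear (\<lambda>p. s (x, p))"
    proof (rule linearI)
      show "s (x, p + r) = s (x, p) + s (x, r)" for p r
        by (rule uniq[OF x]) (simp add: s(2)[OF x] linear_add[OF g_lin1[OF x]] inner_add_left)
      show "s (x, t *\<^sub>R p) = t *\<^sub>R s (x, p)" for t p
        by (rule uniq[OF x]) (simp add: s(2)[OF x] linear_scale[OF g_lin1[OF x]])
    qed
    show "p \<bullet> s (x, r) = r \<bullet> s (x, p)" for p r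
      using s(2)[OF x, of p "s (x, r)"] s(2)[OF x, of r "s (x, p)"] sym[OF x] by metis
    show "p \<bullet> s (x, p) > 0" if "p \<noteq> 0" for p
    proof -
      have "s (x, p) \<noteq> 0"
        using s(2)[OF x, of p p] linear_0[OF g_lin1[OF x]] that by auto
      then show ?thesis using pos[OF x] s(2)[OF x, of p "s (x, p)"] by metis
    qed
  qed
qed

text \<open>\<open>s\<close> is the sharp map and \<open>k\<close> the potential in the chart
  \<open>c\<close>. Recording the fiber derivative as well lets later proofs work without the
  metric.\<close>

definition simple_coords where
  "simple_coords F c s k \<longleftrightarrow>
     smooth_on (snd c ` fst c \<times> UNIV) s \<and> smooth_on (snd c ` fst c) k \<and>
     (\<forall>x\<in>snd c ` fst c.
       linear (\<lambda>p. s (x, p)) \<and> (\<forall>p r. p \<bullet> s (x, r) = r \<bullet> s (x, p)) \<and>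
       (\<forall>p. p \<noteq> 0 \<longrightarrow> p \<bullet> s (x, p) > 0) \<and>
       (\<forall>p. F (chart_inv c x, coord_covec A c (chart_inv c x) p) = 1/2 * (p \<bullet> s (x, p)) + k x) \<and>
       (\<forall>p. fiber_derivative A F (chart_inv c x, coord_covec A c (chart_inv c x) p) =
          (chart_inv c x, coord_tvec A c (chart_inv c x) (s (x, p)))))"

lemma simple_coords_exist:
  assumes F: "simple_hamiltonian A F" and c: "c \<in> A"
  obtains s k where "simple_coords F c s k"
proof -
  let ?M = "snd c ` fst c"
  obtain \<rho> h where rho: "riemannian_metric A \<rho>" and h: "smooth_map A real_atlas h"
    and F_eq: "\<And>\<alpha>. \<alpha> \<in> cotangent_bundle A \<Longrightarrow> F \<alpha> = 1/2 * pairing \<alpha> (sharp A \<rho> \<alpha>) + h (fst \<alpha>)"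
    using F by (auto simp: simple_hamiltonian_def)
  obtain s where s: "smooth_on (?M \<times> UNIV) s"
    "\<And>x p. x \<in> ?M \<Longrightarrow> sharp A \<rho> (chart_inv c x, coord_covec A c (chart_inv c x) p) =
       (chart_inv c x, coord_tvec A c (chart_inv c x) (s (x, p)))"
    "\<And>x. x \<in> ?M \<Longrightarrow> linear (\<lambda>p. s (x, p))" "\<And>x p r. x \<in> ?M \<Longrightarrow> p \<bullet> s (x, r) = r \<bullet> s (x, p)"
    "\<And>x p. x \<in> ?M \<Longrightarrow> p \<noteq> 0 \<Longrightarrow> p \<bullet> s (x, p) > 0"
    using sharp_coordinates[OF rho c] by metis
  define k where "k = h \<circ> chart_inv c"
  have k: "smooth_on ?M k"
    using h c by (auto simp: smooth_map_def real_atlas_def k_def)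
  have F_coord: "F (chart_inv c x, coord_covec A c (chart_inv c x) p) = 1/2 * (p \<bullet> s (x, p)) + k x"
    if x: "x \<in> ?M" for x p
    using chart_inv_charts_at[OF c x]
    by (simp add: F_eq coord_covec_bundle s(2)[OF x] pairing_def k_def)
  have F_fiber: "fiber_derivative A F (chart_inv c x, coord_covec A c (chart_inv c x) p) =
      (chart_inv c x, coord_tvec A c (chart_inv c x) (s (x, p)))" if x: "x \<in> ?M" for x p
  proof -
    let ?q = "chart_inv c x"
    note q = chart_inv_charts_at[OF c x]
    \<comment> \<open>\<open>F\<close> is a quadratic polynomial in \<open>t\<close> along this
      line; the two mixed terms agree by symmetry, so the linear coefficient is
      \<open>r \<bullet> s (x, p)\<close>.\<close>
    have D: "((\<lambda>t. F (?q, \<lambda>w. coord_covec A c ?q p w + t * coord_covec A c ?q r w)) has_real_derivative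
        r \<bullet> s (x, p)) (at 0)" for r
    proof -
      have "F (?q, \<lambda>w. coord_covec A c ?q p w + t * coord_covec A c ?q r w) =
        1/2 * (p \<bullet> s (x, p)) + k x + t * (r \<bullet> s (x, p)) + t\<^sup>2 * (1/2 * (r \<bullet> s (x, r)))" for t
        using F_coord[OF x, of "p + t *\<^sub>R r"] coord_covec_lin[OF q, of 1 p t r] s(4)[OF x, of p r]
        by (simp add: linear_add[OF s(3)[OF x]] linear_scale[OF s(3)[OF x]] inner_add_left inner_add_right
            algebra_simps power2_eq_square)
      then show ?thesis by (auto intro!: derivative_eq_intros)
    qed
    have "(THE v. v \<in> tangent_space A ?q \<and> (\<forall>\<sigma>\<in>cotangent_space A ?q.
        ((\<lambda>t. F (?q, \<lambda>w. coord_covec A c ?q p w + t * \<sigma> w)) has_real_derivative \<sigma> v) (at 0))) =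
        coord_tvec A c ?q (s (x, p))"
    proof (rule the_equality)
      show "coord_tvec A c ?q (s (x, p)) \<in> tangent_space A ?q \<and> (\<forall>\<sigma>\<in>cotangent_space A ?q.
        ((\<lambda>t. F (?q, \<lambda>w. coord_covec A c ?q p w + t * \<sigma> w)) has_real_derivative
          \<sigma> (coord_tvec A c ?q (s (x, p)))) (at 0))"
      proof (intro conjI ballI)
        fix \<sigma> assume \<sigma>: "\<sigma> \<in> cotangent_space A ?q"
        show "((\<lambda>t. F (?q, \<lambda>w. coord_covec A c ?q p w + t * \<sigma> w)) has_real_derivative
          \<sigma> (coord_tvec A c ?q (s (x, p)))) (at 0)"
          using D[of "momentum B A c ?q \<sigma>"] by (simp only: coord_covec_momentum[OF q \<sigma>] inner_momentum[OF q \<sigma>])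
      qed (simp add: q)
      fix v assume v: "v \<in> tangent_space A ?q \<and> (\<forall>\<sigma>\<in>cotangent_space A ?q.
        ((\<lambda>t. F (?q, \<lambda>w. coord_covec A c ?q p w + t * \<sigma> w)) has_real_derivative \<sigma> v) (at 0))"
      \<comment> \<open>Testing against every momentum \<open>r\<close> determines
        \<open>v c\<close> and with it \<open>v\<close>.\<close>
      have "r \<bullet> v c = r \<bullet> s (x, p)" for r
      proof -
        have "coord_covec A c ?q r v = r \<bullet> s (x, p)"
          using v DERIV_unique[OF _ D[of r]] coord_covec_in[OF q, of r] by blast
        then show ?thesis using v by (simp add: coord_covec_def)
      qed
      then have "v c = s (x, p)" using vector_eq_ldot[of "v c" "s (x, p)"] by blast
      then show "v = coord_tvec A c ?q (s (x, p))" using coord_tvec_component[OF q, of v] v by simp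
    qed
    then show ?thesis by (simp add: fiber_derivative_def)
  qed
  have "simple_coords F c s k"
    unfolding simple_coords_def by (intro conjI ballI allI impI s k F_coord F_fiber)
  then show thesis by (rule that)
qed

end

section \<open>The bracket of simple functions\<close>

text \<open>Simpson's rule for the integral of \<open>f'\<close> from 0 to 1, exact because
  \<open>f'\<close> has degree at most 2. The weights reappear in
  \<open>mean_derivative\<close>.\<close>

lemma simpson_cubic:
  fixes f :: "real \<Rightarrow> real"
  assumes "\<And>t. f t = a0 + a1 * t + a2 * t^2 + a3 * t^3" "\<And>t. (f has_real_derivative f' t) (at t)"
  shows "f 1 - f 0 = (f' 0 + 4 * f' (1/2) + f' 1) / 6"
proof -
  have "f = (\<lambda>t. a0 + a1 * t + a2 * t^2 + a3 * t^3)" using assms(1) by auto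
  then have "(f has_real_derivative a1 + 2 * a2 * t + 3 * a3 * t^2) (at t)" for t
    by (auto intro!: derivative_eq_intros)
  then have f': "f' t = a1 + 2 * a2 * t + 3 * a3 * t^2" for t
    using DERIV_unique[OF assms(2)] by blast
  show ?thesis unfolding f' assms(1) by (simp add: power2_eq_square power3_eq_cube field_simps)
qed

lemma cubic_sum:
  fixes f :: "'b \<Rightarrow> real \<Rightarrow> real"
  assumes "\<And>b. b \<in> I \<Longrightarrow> \<exists>a0 a1 a2 a3. \<forall>t. f b t = a0 + a1 * t + a2 * t^2 + a3 * t^3"
  shows "\<exists>a0 a1 a2 a3. \<forall>t. (\<Sum>b\<in>I. f b t) = a0 + a1 * t + a2 * t^2 + a3 * t^3"
proof -
  obtain a0 a1 a2 a3 where "\<And>b t. b \<in> I \<Longrightarrow> f b t = a0 b + a1 b * t + a2 b * t^2 + a3 b * t^3"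
    using assms by metis
  then have "(\<Sum>b\<in>I. f b t) = (\<Sum>b\<in>I. a0 b) + (\<Sum>b\<in>I. a1 b) * t + (\<Sum>b\<in>I. a2 b) * t^2 + (\<Sum>b\<in>I. a3 b) * t^3" for t
    by (simp add: sum.distrib sum_distrib_right)
  then show ?thesis by blast
qed

lemma smooth_on_coordinate_bracket:
  assumes "open S" "smooth_on S f" "smooth_on S g"
  shows "smooth_on S (coordinate_bracket B f g)"
proof (rule smooth_on_cong[OF assms(1)])
  let ?f = "\<lambda>z. frechet_derivative f (at z)" and ?g = "\<lambda>z. frechet_derivative g (at z)"
  show "(\<Sum>b\<in>B. ?f z (b, 0) * ?g z (0, b) - ?g z (b, 0) * ?f z (0, b)) = coordinate_bracket B f g z"
    if "z \<in> S" for z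
    unfolding coordinate_bracket_def
      directional_derivative_eq[OF smooth_on_has_derivative[OF assms(2) that]]
      directional_derivative_eq[OF smooth_on_has_derivative[OF assms(3) that]] ..
  show "smooth_on S (\<lambda>z. \<Sum>b\<in>B. ?f z (b, 0) * ?g z (0, b) - ?g z (b, 0) * ?f z (0, b))"
    by (intro smooth_on_sum smooth_on_diff smooth_on_mult smooth_on_derivative assms)
qed

section \<open>Dependence of the bracket on the momentum\<close>

context smooth_atlas
begin

lemma onb2: "orthonormal_basis ((\<lambda>b. (b, 0)) ` B \<union> (\<lambda>b. (0, b)) ` B)"
  by (rule orthonormal_basis_prod[OF onb onb])

lemma simple_coordsD:
  assumes "simple_coords F c s k"
  shows "smooth_on (snd c ` fst c \<times> UNIV) s" "smooth_on (snd c ` fst c) k"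
    and "x \<in> snd c ` fst c \<Longrightarrow> linear (\<lambda>p. s (x, p))"
    and "x \<in> snd c ` fst c \<Longrightarrow> p \<bullet> s (x, r) = r \<bullet> s (x, p)"
    and "x \<in> snd c ` fst c \<Longrightarrow> p \<noteq> 0 \<Longrightarrow> p \<bullet> s (x, p) > 0"
    and "x \<in> snd c ` fst c \<Longrightarrow>
      F (chart_inv c x, coord_covec A c (chart_inv c x) p) = 1/2 * (p \<bullet> s (x, p)) + k x"
    and "x \<in> snd c ` fst c \<Longrightarrow> fiber_derivative A F (chart_inv c x, coord_covec A c (chart_inv c x) p) =
      (chart_inv c x, coord_tvec A c (chart_inv c x) (s (x, p)))"
  using assms unfolding simple_coords_def by blast+

abbreviation local_rep :: "('q, 'e) chart \<Rightarrow> ('q \<times> ('q, 'e) covec \<Rightarrow> real) \<Rightarrow> 'e \<times> 'e \<Rightarrow> real" where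
  "local_rep c F \<equiv> F \<circ> chart_inv (cotangent_chart B A c)"

lemma open_chart_image_prod: "c \<in> A \<Longrightarrow> open (snd c ` fst c \<times> (UNIV :: 'e set))"
  by (intro open_Times open_UNIV open_chart_image)

context
  fixes F c s k
  assumes sc: "simple_coords F c s k" and c: "c \<in> A"
begin

lemma local_rep_simple:
  assumes "x \<in> snd c ` fst c"
  shows "local_rep c F (x, p) = 1/2 * (p \<bullet> s (x, p)) + k x"
  using simple_coordsD(6)[OF sc assms] by (simp add: chart_inv_cotangent_chart[OF c assms])

lemma smooth_on_snd_inner:
  shows "smooth_on (snd c ` fst c) (\<lambda>x. r \<bullet> s (x, p))"
proof -
  have "smooth_on (snd c ` fst c) (\<lambda>x. (x, p))"
    by (intro smooth_on_Pair open_chart_image[OF c] smooth_on_const smooth_on_bounded_linear bounded_linear_ident)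
  from smooth_on_compose[OF onb2 open_chart_image[OF c] open_chart_image_prod[OF c] _ simple_coordsD(1)[OF sc] this]
  show ?thesis by (intro smooth_on_inner open_chart_image[OF c] smooth_on_const) auto
qed

lemma smooth_local_rep: "smooth_on (snd c ` fst c \<times> UNIV) (local_rep c F)"
proof (rule smooth_on_cong[OF open_chart_image_prod[OF c]])
  let ?S = "snd c ` fst c \<times> (UNIV :: 'e set)"
  show "1/2 * (snd z \<bullet> s z) + k (fst z) = local_rep c F z" if "z \<in> ?S" for z
    using that local_rep_simple[of "fst z" "snd z"] by auto
  have k: "smooth_on ?S (\<lambda>z. k (fst z))"
    by (rule smooth_on_compose[where f = k and g = fst, OF onb open_chart_image_prod[OF c] open_chart_image[OF c] _
          simple_coordsD(2)[OF sc]])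
      (auto intro: smooth_on_bounded_linear open_chart_image_prod[OF c] bounded_linear_fst)
  show "smooth_on ?S (\<lambda>z. 1/2 * (snd z \<bullet> s z) + k (fst z))"
    by (intro smooth_on_add k smooth_on_mult smooth_on_inner open_chart_image_prod[OF c] smooth_on_const
        simple_coordsD(1)[OF sc] smooth_on_bounded_linear bounded_linear_snd)
qed

context
  fixes x assumes x: "x \<in> snd c ` fst c"
begin

lemma has_derivative_local_rep:
  "(local_rep c F has_derivative frechet_derivative (local_rep c F) (at (x, p))) (at (x, p))"
  by (rule smooth_on_has_derivative[OF smooth_local_rep]) (use x in simp)

text \<open>Differentiability comes from the smoothness of \<open>local_rep\<close>, but the
  function is written out, so that it can be rearranged in the momentum and compared by uniqueness
  of derivatives.\<close>

lemma base_derivative: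
  "((\<lambda>y. 1/2 * (p \<bullet> s (y, p)) + k y) has_derivative
     (\<lambda>v. directional_derivative (local_rep c F) (x, p) (v, 0))) (at x)"
proof -
  have "((\<lambda>y. local_rep c F (y, p)) has_derivative
      (\<lambda>v. frechet_derivative (local_rep c F) (at (x, p)) (v, 0))) (at x)"
    by (rule has_derivative_compose[OF has_derivative_Pair[OF has_derivative_ident has_derivative_const]
          has_derivative_local_rep])
  from has_derivative_transform_within_open[OF this open_chart_image[OF c] x local_rep_simple]
  show ?thesis by (simp add: directional_derivative_eq[OF has_derivative_local_rep])
qed

lemma fiber_directional_derivative:
  "directional_derivative (local_rep c F) (x, p) (0, v) = v \<bullet> s (x, p)"
proof -
  note lin = simple_coordsD(3)[OF sc x]
  have eq: "(\<lambda>t. local_rep c F ((x, p) + t *\<^sub>R (0, v))) =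
      (\<lambda>t. (1/2 * (p \<bullet> s (x, p)) + k x) + t * (v \<bullet> s (x, p)) + t\<^sup>2 * (1/2 * (v \<bullet> s (x, v))))"
    using simple_coordsD(4)[OF sc x, of p v] local_rep_simple[OF x]
    by (simp add: fun_eq_iff linear_add[OF lin] linear_scale[OF lin] inner_add_left inner_add_right
        algebra_simps power2_eq_square)
  show ?thesis
    unfolding directional_derivative_def eq by (rule DERIV_imp_deriv) (auto intro!: derivative_eq_intros)
qed

text \<open>The kinetic term is a quadratic form in the momentum at every base point: it is expanded
  in \<open>t\<close> first, and the coefficients are differentiated in \<open>y\<close>
  afterwards.\<close>

lemma base_directional_derivative_quadratic:
  "\<exists>a0 a1 a2. \<forall>t. directional_derivative (local_rep c F) (x, p + t *\<^sub>R r) (v, 0) = a0 + a1 * t + a2 * t\<^sup>2"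
proof -
  have D: "((\<lambda>y. a \<bullet> s (y, b)) has_derivative frechet_derivative (\<lambda>y. a \<bullet> s (y, b)) (at x)) (at x)" for a b
    by (rule smooth_on_has_derivative[OF smooth_on_snd_inner x])
  let ?d = "\<lambda>a b. frechet_derivative (\<lambda>y. a \<bullet> s (y, b)) (at x) v"
  have "directional_derivative (local_rep c F) (x, p + t *\<^sub>R r) (v, 0) =
      directional_derivative (local_rep c F) (x, p) (v, 0) + ?d r p * t + (1/2 * ?d r r) * t\<^sup>2" for t
  proof -
    have "((\<lambda>y. (1/2 * (p \<bullet> s (y, p)) + k y) + t * (r \<bullet> s (y, p)) + t\<^sup>2 * (1/2 * (r \<bullet> s (y, r)))) has_derivative
        (\<lambda>v. directional_derivative (local_rep c F) (x, p) (v, 0) +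
          t * frechet_derivative (\<lambda>y. r \<bullet> s (y, p)) (at x) v +
          t\<^sup>2 * (1/2 * frechet_derivative (\<lambda>y. r \<bullet> s (y, r)) (at x) v))) (at x)"
      by (intro has_derivative_add base_derivative has_derivative_mult_right D)
    then have "((\<lambda>y. 1/2 * ((p + t *\<^sub>R r) \<bullet> s (y, p + t *\<^sub>R r)) + k y) has_derivative
        (\<lambda>v. directional_derivative (local_rep c F) (x, p) (v, 0) +
          t * frechet_derivative (\<lambda>y. r \<bullet> s (y, p)) (at x) v +
          t\<^sup>2 * (1/2 * frechet_derivative (\<lambda>y. r \<bullet> s (y, r)) (at x) v))) (at x)"
    proof (rule has_derivative_transform_within_open[OF _ open_chart_image[OF c] x])
      fix y assume y: "y \<in> snd c ` fst c"
      note lin = simple_coordsD(3)[OF sc y]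
      show "(1/2 * (p \<bullet> s (y, p)) + k y) + t * (r \<bullet> s (y, p)) + t\<^sup>2 * (1/2 * (r \<bullet> s (y, r))) =
          1/2 * ((p + t *\<^sub>R r) \<bullet> s (y, p + t *\<^sub>R r)) + k y"
        using simple_coordsD(4)[OF sc y, of p r]
        by (simp add: linear_add[OF lin] linear_scale[OF lin] inner_add_left inner_add_right
            algebra_simps power2_eq_square)
    qed
    from fun_cong[OF has_derivative_unique[OF base_derivative this], of v] show ?thesis by simp
  qed
  then show ?thesis by blast
qed

text \<open>The sign change leaves the quadratic form \<open>p \<bullet> s (y, p)\<close> fixed and
  reverses \<open>s\<close> itself.\<close>

lemma directional_derivative_uminus:
  "directional_derivative (local_rep c F) (x, - p) (v, 0) = directional_derivative (local_rep c F) (x, p) (v, 0)"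
  "directional_derivative (local_rep c F) (x, - p) (0, v) = - directional_derivative (local_rep c F) (x, p) (0, v)"
proof -
  have neg: "s (y, - p) = - s (y, p)" if "y \<in> snd c ` fst c" for y
    using linear_neg[OF simple_coordsD(3)[OF sc that]] .
  have "((\<lambda>y. 1/2 * ((- p) \<bullet> s (y, - p)) + k y) has_derivative
      (\<lambda>v. directional_derivative (local_rep c F) (x, p) (v, 0))) (at x)"
    by (rule has_derivative_transform_within_open[OF base_derivative open_chart_image[OF c] x]) (simp add: neg)
  from fun_cong[OF has_derivative_unique[OF base_derivative this]]
  show "directional_derivative (local_rep c F) (x, - p) (v, 0) = directional_derivative (local_rep c F) (x, p) (v, 0)" .
  show "directional_derivative (local_rep c F) (x, - p) (0, v) = - directional_derivative (local_rep c F) (x, p) (0, v)"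
    by (simp add: fiber_directional_derivative neg x)
qed

end

end

context
  fixes F G c s k s' k'
  assumes sF: "simple_coords F c s k" and sG: "simple_coords G c s' k'" and c: "c \<in> A"
begin

lemma smooth_local_bracket:
  "smooth_on (snd c ` fst c \<times> UNIV) (coordinate_bracket B (local_rep c F) (local_rep c G))"
  by (intro smooth_on_coordinate_bracket open_chart_image_prod[OF c] smooth_local_rep[OF sF c]
      smooth_local_rep[OF sG c])

text \<open>Each product contains one base derivative, even in \<open>p\<close>, and one fiber
  derivative, odd in \<open>p\<close>.\<close>

lemma local_bracket_odd:
  assumes "x \<in> snd c ` fst c"
  shows "coordinate_bracket B (local_rep c F) (local_rep c G) (x, - p) =
    - coordinate_bracket B (local_rep c F) (local_rep c G) (x, p)"
  unfolding coordinate_bracket_def directional_derivative_uminus[OF sF c assms]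
    directional_derivative_uminus[OF sG c assms]
  by (simp add: sum_subtractf)

text \<open>Base derivatives have degree at most 2 in \<open>t\<close>, fiber derivatives at most 1.
  This makes \<open>simpson_cubic\<close> applicable to the bracket.\<close>

lemma local_bracket_cubic:
  assumes x: "x \<in> snd c ` fst c"
  shows "\<exists>a0 a1 a2 a3. \<forall>t. coordinate_bracket B (local_rep c F) (local_rep c G) (x, p + t *\<^sub>R r) =
    a0 + a1 * t + a2 * t^2 + a3 * t^3"
  unfolding coordinate_bracket_def
proof (rule cubic_sum)
  fix b
  obtain a0 a1 a2 where a: "\<And>t. directional_derivative (local_rep c F) (x, p + t *\<^sub>R r) (b, 0) = a0 + a1 * t + a2 * t^2"
    using base_directional_derivative_quadratic[OF sF c x] by metis
  obtain d0 d1 d2 where d: "\<And>t. directional_derivative (local_rep c G) (x, p + t *\<^sub>R r) (b, 0) = d0 + d1 * t + d2 * t^2"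
    using base_directional_derivative_quadratic[OF sG c x] by metis
  note lin = simple_coordsD(3)[OF sF x] simple_coordsD(3)[OF sG x]
  let ?u = "\<lambda>q. b \<bullet> s (x, q)" and ?w = "\<lambda>q. b \<bullet> s' (x, q)"
  show "\<exists>e0 e1 e2 e3. \<forall>t. directional_derivative (local_rep c F) (x, p + t *\<^sub>R r) (b, 0) *
        directional_derivative (local_rep c G) (x, p + t *\<^sub>R r) (0, b) -
      directional_derivative (local_rep c G) (x, p + t *\<^sub>R r) (b, 0) *
        directional_derivative (local_rep c F) (x, p + t *\<^sub>R r) (0, b) = e0 + e1 * t + e2 * t^2 + e3 * t^3"
    unfolding a d fiber_directional_derivative[OF sF c x] fiber_directional_derivative[OF sG c x]
  proof (intro exI allI)
    show "(a0 + a1 * t + a2 * t\<^sup>2) * ?w (p + t *\<^sub>R r) - (d0 + d1 * t + d2 * t\<^sup>2) * ?u (p + t *\<^sub>R r) =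
      (a0 * ?w p - d0 * ?u p) + (a1 * ?w p + a0 * ?w r - d1 * ?u p - d0 * ?u r) * t +
      (a2 * ?w p + a1 * ?w r - d2 * ?u p - d1 * ?u r) * t^2 + (a2 * ?w r - d2 * ?u r) * t^3" for t
      by (simp add: linear_add[OF lin(1)] linear_scale[OF lin(1)] linear_add[OF lin(2)] linear_scale[OF lin(2)]
          inner_add_right algebra_simps power2_eq_square power3_eq_cube)
  qed
qed

end

text \<open>The \<open>THE\<close> in \<open>poisson_bracket\<close> is meaningful only if all
  canonical charts agree; \<open>coordinate_bracket_change\<close>, applied to the passage from
  \<open>c\<close> to any \<open>d\<close>, provides this.\<close>

lemma poisson_bracket_coords:
  assumes F: "simple_hamiltonian A F" and G: "simple_hamiltonian A G" and c: "c \<in> A"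
    and x: "x \<in> snd c ` fst c"
  shows "poisson_bracket B A F G (chart_inv c x, coord_covec A c (chart_inv c x) p) =
    coordinate_bracket B (local_rep c F) (local_rep c G) (x, p)"
proof -
  let ?q = "chart_inv c x"
  note q = chart_inv_charts_at[OF c x]
  let ?a = "coord_covec A c ?q p"
  have eq: "coordinate_bracket B (local_rep d F) (local_rep d G) (snd (cotangent_chart B A d) (?q, ?a)) =
      coordinate_bracket B (local_rep c F) (local_rep c G) (x, p)" if dq: "d \<in> charts_at A ?q" for d
  proof -
    note d = charts_atD(1)[OF dq]
    let ?S = "snd c ` (fst c \<inter> fst d)" and ?\<tau> = "transition c d"
    let ?T = "\<lambda>x r. \<Sum>b\<in>B. (frechet_derivative ?\<tau> (at x) b \<bullet> r) *\<^sub>R b"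
    \<comment> \<open>The momentum of the same covector in the chart \<open>d\<close>; the change
      formula then reads \<open>?T x r = p\<close>.\<close>
    define r where "r = momentum B A d ?q ?a"
    have snd_c: "snd c ?q = x" using c x by simp
    have \<tau>x: "?\<tau> x = snd d ?q" using transition_chart[of c ?q d] c x by (simp add: chart_inv_in snd_c)
    have "coord_covec A d ?q r = ?a"
      unfolding r_def by (rule coord_covec_momentum[OF dq]) (simp add: q)
    then have pr: "?T x r = p"
      using coord_covec_change[OF q dq, of r] by (simp add: coord_covec_inject[OF q] snd_c)
    have xS: "x \<in> ?S"
      using charts_atD(2)[OF q] charts_atD(2)[OF dq] snd_c by (metis IntI imageI)
    have rep: "local_rep c E (x', ?T x' r') = local_rep d E (?\<tau> x', r')" if "x' \<in> ?S" for E x' r'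
    proof -
      let ?q' = "chart_inv c x'"
      have q': "?q' \<in> fst c" "?q' \<in> fst d" and x': "x' \<in> snd c ` fst c" "snd c ?q' = x'"
        using that c by auto
      then have \<tau>x': "?\<tau> x' = snd d ?q'" using transition_chart[of c ?q' d] c by simp
      then have "?\<tau> x' \<in> snd d ` fst d" "chart_inv d (?\<tau> x') = ?q'" using q' d by auto
      then show ?thesis
        using coord_covec_change[OF charts_atI[OF c q'(1)] charts_atI[OF d q'(2)], of r'] x'
        by (simp add: chart_inv_cotangent_chart c d)
    qed
    have S: "open ?S" using c d by (rule open_overlap)
    have smooth: "smooth_on (snd e ` fst e \<times> UNIV) (local_rep e E)" if "e \<in> A" "simple_hamiltonian A E" for e E
      using simple_coords_exist[OF that(2,1)] smooth_local_rep that(1) by metis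
    have Dc: "(local_rep c E has_derivative frechet_derivative (local_rep c E) (at (x, ?T x r))) (at (x, ?T x r))"
      if "simple_hamiltonian A E" for E
      by (rule smooth_on_has_derivative[OF smooth[OF c that]]) (use x in simp)
    have Dd: "(local_rep d E has_derivative frechet_derivative (local_rep d E) (at (?\<tau> x, r))) (at (?\<tau> x, r))"
      if "simple_hamiltonian A E" for E
      by (rule smooth_on_has_derivative[OF smooth[OF d that]]) (use \<tau>x charts_atD(2)[OF dq] in simp)
    have "coordinate_bracket B (local_rep c F) (local_rep c G) (x, ?T x r) =
        coordinate_bracket B (local_rep d F) (local_rep d G) (?\<tau> x, r)"
      by (rule coordinate_bracket_change[OF onb S xS smooth_transition[OF c d] Dc[OF F] Dd[OF F] rep Dc[OF G] Dd[OF G] rep])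
    then show ?thesis unfolding pr by (simp add: \<tau>x cotangent_chart_apply r_def)
  qed
  have "(?q, ?a) \<in> cotangent_bundle A" by (rule coord_covec_bundle[OF q])
  then have "poisson_bracket B A F G (?q, ?a) = (THE r. \<forall>d\<in>charts_at A ?q.
      r = coordinate_bracket B (local_rep c F) (local_rep c G) (x, p))"
    unfolding poisson_bracket_def by (simp add: charts_at_cotangent_atlas eq cong: ball_cong)
  also have "\<dots> = coordinate_bracket B (local_rep c F) (local_rep c G) (x, p)"
    \<comment> \<open>The chart \<open>c\<close> keeps the quantifier over charts from being
      vacuous, as uniqueness requires.\<close>
    using q by (intro the_equality) blast+
  finally show ?thesis .
qed

end

section \<open>Construction of the control\<close>

lemma span_image_sum:
  fixes f :: "'i \<Rightarrow> 'a::real_vector"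
  assumes "finite I"
  shows "span (f ` I) = range (\<lambda>r. \<Sum>i\<in>I. r i *\<^sub>R f i)"
proof
  show "range (\<lambda>r. \<Sum>i\<in>I. r i *\<^sub>R f i) \<subseteq> span (f ` I)"
    by (auto intro!: span_sum span_scale intro: span_base)
  show "span (f ` I) \<subseteq> range (\<lambda>r. \<Sum>i\<in>I. r i *\<^sub>R f i)"
  proof (rule span_minimal)
    show "f ` I \<subseteq> range (\<lambda>r. \<Sum>i\<in>I. r i *\<^sub>R f i)"
    proof (intro image_subsetI)
      fix j assume "j \<in> I"
      have "(\<Sum>i\<in>I. (if i = j then 1 else 0) *\<^sub>R f i) = (\<Sum>i\<in>I. if i = j then f i else 0)"
        by (intro sum.cong) auto
      then have "(\<Sum>i\<in>I. (if i = j then 1 else 0) *\<^sub>R f i) = f j"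
        using \<open>j \<in> I\<close> assms by simp
      from this[symmetric] show "f j \<in> range (\<lambda>r. \<Sum>i\<in>I. r i *\<^sub>R f i)"
        by (rule range_eqI[where x = "\<lambda>i. if i = j then 1 else 0"])
    qed
    show "subspace (range (\<lambda>r. \<Sum>i\<in>I. r i *\<^sub>R f i))"
    proof (rule subspaceI)
      show "0 \<in> range (\<lambda>r. \<Sum>i\<in>I. r i *\<^sub>R f i)"
        by (intro range_eqI[of _ _ "\<lambda>_. 0"]) simp
      fix u assume "u \<in> range (\<lambda>r. \<Sum>i\<in>I. r i *\<^sub>R f i)"
      then obtain r where r: "u = (\<Sum>i\<in>I. r i *\<^sub>R f i)" by auto
      show "t *\<^sub>R u \<in> range (\<lambda>r. \<Sum>i\<in>I. r i *\<^sub>R f i)" for t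
        by (intro range_eqI[of _ _ "\<lambda>i. t * r i"]) (simp add: r scaleR_sum_right)
      fix w assume "w \<in> range (\<lambda>r. \<Sum>i\<in>I. r i *\<^sub>R f i)"
      then obtain r' where r': "w = (\<Sum>i\<in>I. r' i *\<^sub>R f i)" by auto
      show "u + w \<in> range (\<lambda>r. \<Sum>i\<in>I. r i *\<^sub>R f i)"
        by (intro range_eqI[of _ _ "\<lambda>i. r i + r' i"]) (simp add: r r' scaleR_add_left sum.distrib)
    qed
  qed
qed

text \<open>Passes from independence by coefficients, as in \<open>linear_subbundle\<close>, to the
  triangular form used by \<open>smooth_riesz\<close>.\<close>

lemma not_in_span_initial:
  fixes f :: "nat \<Rightarrow> 'a::real_vector"
  assumes "\<And>r i. (\<Sum>j<k. r j *\<^sub>R f j) = 0 \<Longrightarrow> i < k \<Longrightarrow> r i = 0" "i < k"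
  shows "f i \<notin> span (f ` {..<i})"
proof
  assume "f i \<in> span (f ` {..<i})"
  then obtain r where r: "f i = (\<Sum>j<i. r j *\<^sub>R f j)" by (auto simp: span_image_sum)
  \<comment> \<open>A dependence of \<open>f i\<close> on its predecessors becomes a relation among
    all \<open>k\<close> vectors; the \<open>- 1\<close> at \<open>i\<close> makes it
    nontrivial.\<close>
  define r' where "r' j = (if j < i then r j else if j = i then - 1 else 0)" for j
  have "(\<Sum>j<k. r' j *\<^sub>R f j) = (\<Sum>j<Suc i. r' j *\<^sub>R f j)"
    using assms(2) by (intro sum.mono_neutral_right) (auto simp: r'_def)
  also have "\<dots> = (\<Sum>j<i. r j *\<^sub>R f j) - f i"
    by (simp add: r'_def)
  finally have "(\<Sum>j<k. r' j *\<^sub>R f j) = 0" using r by simp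
  from assms(1)[OF this assms(2)] show False by (simp add: r'_def)
qed

context smooth_atlas
begin

text \<open>The frame covectors live in different fibers, while their momenta \<open>om i x\<close>
  all lie in the model space, where \<open>smooth_riesz\<close> applies.\<close>

lemma subbundle_coords:
  assumes W: "linear_subbundle B X A W" and c: "c \<in> A" and q0: "q0 \<in> fst c"
  obtains U om and k :: nat where "openin X U" "q0 \<in> U"
    "\<And>i. i < k \<Longrightarrow> smooth_on (snd c ` (fst c \<inter> U)) (om i)"
    "\<And>i x. i < k \<Longrightarrow> x \<in> snd c ` (fst c \<inter> U) \<Longrightarrow> om i x \<notin> span ((\<lambda>j. om j x) ` {..<i})"
    "\<And>x. x \<in> snd c ` (fst c \<inter> U) \<Longrightarrow> fiber W (chart_inv c x) =
      (\<lambda>p. (chart_inv c x, coord_covec A c (chart_inv c x) p)) ` span ((\<lambda>j. om j x) ` {..<k})"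
proof -
  have "q0 \<in> points A" using c q0 by (auto simp: points_def)
  from W[unfolded linear_subbundle_def, THEN conjunct2, THEN bspec, OF this]
  obtain U and k :: nat and \<omega> where U: "openin X U" "q0 \<in> U"
    and smooth: "\<forall>i<k. smooth_map (open_submanifold A U) (cotangent_atlas B A) (\<lambda>q. (q, \<omega> i q))"
    and frame: "\<forall>q\<in>U. (\<forall>r. (\<lambda>v. \<Sum>i<k. r i * \<omega> i q v) = (\<lambda>_. 0) \<longrightarrow> (\<forall>i<k. r i = 0)) \<and>
      fiber W q = {(q, \<lambda>v. \<Sum>i<k. r i * \<omega> i q v) | r. True}"
    by (elim exE conjE) (rule that)
  have \<omega>: "smooth_map (open_submanifold A U) (cotangent_atlas B A) (\<lambda>q. (q, \<omega> i q))" if "i < k" for i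
    using smooth that by blast
  have ind: "r i = 0" if "q \<in> U" "(\<lambda>v. \<Sum>i<k. r i * \<omega> i q v) = (\<lambda>_. 0)" "i < k" for q r i
    using frame that by blast
  have fib: "fiber W q = {(q, \<lambda>v. \<Sum>i<k. r i * \<omega> i q v) | r. True}" if "q \<in> U" for q
    using frame that by blast
  define om where "om i x = momentum B A c (chart_inv c x) (\<omega> i (chart_inv c x))" for i x
  let ?V = "snd c ` (fst c \<inter> U)"
  have in_cot: "\<omega> i q \<in> cotangent_space A q" if "i < k" "q \<in> U" for i q
  proof -
    have "q \<in> points A" using that U(1) openin_subset points_eq by blast
    then have "q \<in> points (open_submanifold A U)"
      using that by (auto simp: points_def open_submanifold_def)
    then have "(q, \<omega> i q) \<in> points (cotangent_atlas B A)"
      using \<omega>[OF that(1)] unfolding smooth_map_def by blast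
    then show ?thesis by (simp add: points_cotangent_atlas cotangent_bundle_def)
  qed
  have V: "x \<in> snd c ` fst c" "chart_inv c x \<in> U" "c \<in> charts_at A (chart_inv c x)" if "x \<in> ?V" for x
    using that c by (auto intro: charts_atI)
  have \<omega>_eq: "\<omega> i (chart_inv c x) = coord_covec A c (chart_inv c x) (om i x)" if "i < k" "x \<in> ?V" for i x
    unfolding om_def by (rule coord_covec_momentum[OF V(3) in_cot, symmetric]) (use that V in auto)
  show thesis
  proof (rule that[of U k om])
    fix i assume i: "i < k"
    let ?c = "(U \<inter> fst c, snd c)" and ?C = "cotangent_chart B A c"
    \<comment> \<open>A section takes values over its own base point, so the chart condition on the
      values becomes one on \<open>q\<close>.\<close>
    have dom: "fst ?c \<inter> (\<lambda>q. (q, \<omega> i q)) -` fst ?C = fst c \<inter> U"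
      using in_cot[OF i] c by (auto simp: cotangent_chart_dom cotangent_bundle_def points_def)
    have "?c \<in> open_submanifold A U" "?C \<in> cotangent_atlas B A"
      using c by (auto simp: open_submanifold_def cotangent_atlas_def)
    then have "smooth_on (snd ?c ` (fst ?c \<inter> (\<lambda>q. (q, \<omega> i q)) -` fst ?C))
        (snd ?C \<circ> (\<lambda>q. (q, \<omega> i q)) \<circ> chart_inv ?c)"
      using \<omega>[OF i] unfolding smooth_map_def by blast
    then have 1: "smooth_on ?V (snd ?C \<circ> (\<lambda>q. (q, \<omega> i q)) \<circ> chart_inv ?c)"
      unfolding dom by simp
    have opn: "open ?V" by (rule open_chart_overlap[OF c U(1)])
    show "smooth_on ?V (om i)"
    proof (rule smooth_on_cong[OF opn _ smooth_on_linear[OF opn bounded_linear_snd 1]])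
      fix x assume x: "x \<in> ?V"
      then obtain q where q: "q \<in> fst c" "q \<in> U" "x = snd c q" by auto
      \<comment> \<open>\<open>chart_inv ?c\<close> inverts over the smaller domain, so its
        agreement with \<open>chart_inv c\<close> has to be derived from injectivity.\<close>
      have "inj_on (snd c) (U \<inter> fst c)" using inj_on_chart[OF c] by (rule inj_on_subset) auto
      then have "chart_inv ?c x = q" using q by (simp add: chart_inv_def)
      moreover have "chart_inv c x = q" using q c by simp
      ultimately show "snd ((snd ?C \<circ> (\<lambda>q. (q, \<omega> i q)) \<circ> chart_inv ?c) x) = om i x"
        by (simp add: om_def cotangent_chart_apply)
    qed
    fix x assume x: "x \<in> ?V"
    let ?q = "chart_inv c x"
    show "om i x \<notin> span ((\<lambda>j. om j x) ` {..<i})"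
    proof (rule not_in_span_initial[OF _ i])
      fix r i assume "(\<Sum>j<k. r j *\<^sub>R om j x) = 0" and i: "i < k"
      then have "coord_covec A c ?q (\<Sum>j<k. r j *\<^sub>R om j x) = (\<lambda>_. 0)"
        by (simp add: coord_covec_def fun_eq_iff)
      then have "(\<lambda>v. \<Sum>j<k. r j * \<omega> j ?q v) = (\<lambda>_. 0)"
        using \<omega>_eq x by (simp add: coord_covec_sum[OF V(3)[OF x]])
      then show "r i = 0" by (rule ind[OF V(2)[OF x] _ i])
    qed
  next
    fix x assume x: "x \<in> ?V"
    let ?q = "chart_inv c x"
    have "(?q, \<lambda>v. \<Sum>i<k. r i * \<omega> i ?q v) = (?q, coord_covec A c ?q (\<Sum>i<k. r i *\<^sub>R om i x))" for r
      using \<omega>_eq x by (simp add: coord_covec_sum[OF V(3)[OF x]])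
    then show "fiber W ?q = (\<lambda>p. (?q, coord_covec A c ?q p)) ` span ((\<lambda>j. om j x) ` {..<k})"
      unfolding fib[OF V(2)[OF x]] by (auto simp: span_image_sum)
  qed (use U in auto)
qed

text \<open>If \<open>FD\<close> is the fiber derivative of a simple function,
  \<open>pairing \<omega> (FD \<eta>)\<close> is the cometric product of \<open>\<omega>\<close> and
  \<open>\<eta>\<close>, and the condition says that \<open>\<alpha> - \<eta>\<close> is orthogonal
  to \<open>W\<close>.\<close>

definition orthogonal_part where
  "orthogonal_part W FD \<alpha> = (THE \<eta>. \<eta> \<in> fiber W (fst \<alpha>) \<and>
     (\<forall>\<omega>\<in>fiber W (fst \<alpha>). pairing \<omega> (FD \<eta>) = pairing \<omega> (FD \<alpha>)))"

definition covec_shift :: "'q \<times> ('q, 'e) covec \<Rightarrow> real \<Rightarrow> ('q, 'e) covec \<Rightarrow> 'q \<times> ('q, 'e) covec" where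
  "covec_shift \<alpha> t \<sigma> = (fst \<alpha>, \<lambda>v. snd \<alpha> v + t * \<sigma> v)"

text \<open>
  By Simpson's rule this is the integral of the derivative of \<open>F\<close> in the direction \<open>\<sigma>\<close> along the segment
  from \<open>\<alpha> - \<beta>\<close> to \<open>\<alpha>\<close>, because \<open>F\<close> will be a cubic polynomial on each fiber.
\<close>

definition mean_derivative where
  "mean_derivative F \<beta> \<alpha> \<sigma> =
    (deriv (\<lambda>t. F (covec_shift (covec_shift \<alpha> (- 1) \<beta>) t \<sigma>)) 0 +
     4 * deriv (\<lambda>t. F (covec_shift (covec_shift \<alpha> (- 1/2) \<beta>) t \<sigma>)) 0 +
     deriv (\<lambda>t. F (covec_shift \<alpha> t \<sigma>)) 0) / 6"

text \<open>Same shape as \<open>orthogonal_part\<close>, so that \<open>fiber_riesz_unique\<close>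
  evaluates both. Neither mentions a chart or a frame, hence local computations need no
  gluing.\<close>

definition control where
  "control W FD F \<alpha> = (THE \<eta>. \<eta> \<in> fiber W (fst \<alpha>) \<and> (\<forall>\<omega>\<in>fiber W (fst \<alpha>).
     pairing \<omega> (FD \<eta>) = - mean_derivative F (snd (orthogonal_part W FD \<alpha>)) \<alpha> (snd \<omega>)))"

text \<open>Two solutions differ by an element of \<open>V\<close> orthogonal to \<open>V\<close>,
  hence to itself, and positivity makes it zero. Existence is supplied by the given
  \<open>R\<close>.\<close>

lemma fiber_riesz_unique:
  assumes sF: "simple_coords F c s k" and c: "c \<in> A" and x: "x \<in> snd c ` fst c"
    and V: "subspace V" "R \<in> V" "\<And>w. w \<in> V \<Longrightarrow> w \<bullet> s (x, R) = l (coord_covec A c (chart_inv c x) w)"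
    and fib: "fiber W (chart_inv c x) = (\<lambda>p. (chart_inv c x, coord_covec A c (chart_inv c x) p)) ` V"
  shows "(THE \<eta>. \<eta> \<in> fiber W (chart_inv c x) \<and> (\<forall>\<omega>\<in>fiber W (chart_inv c x).
      pairing \<omega> (fiber_derivative A F \<eta>) = l (snd \<omega>))) =
    (chart_inv c x, coord_covec A c (chart_inv c x) R)"
proof -
  let ?q = "chart_inv c x"
  note q = chart_inv_charts_at[OF c x]
  have pair: "pairing (?q, coord_covec A c ?q w) (fiber_derivative A F (?q, coord_covec A c ?q p)) = w \<bullet> s (x, p)" for w p
    by (simp add: pairing_def simple_coordsD(7)[OF sF x] q)
  show ?thesis
  proof (rule the_equality)
    show "(?q, coord_covec A c ?q R) \<in> fiber W ?q \<and> (\<forall>\<omega>\<in>fiber W ?q.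
        pairing \<omega> (fiber_derivative A F (?q, coord_covec A c ?q R)) = l (snd \<omega>))"
      unfolding fib using V by (auto simp: pair)
    fix \<eta> assume \<eta>: "\<eta> \<in> fiber W ?q \<and> (\<forall>\<omega>\<in>fiber W ?q. pairing \<omega> (fiber_derivative A F \<eta>) = l (snd \<omega>))"
    then obtain p where p: "p \<in> V" "\<eta> = (?q, coord_covec A c ?q p)" unfolding fib by auto
    have "w \<bullet> s (x, p) = w \<bullet> s (x, R)" if "w \<in> V" for w
    proof -
      have "(?q, coord_covec A c ?q w) \<in> fiber W ?q" using that by (auto simp: fib)
      then have "pairing (?q, coord_covec A c ?q w) (fiber_derivative A F \<eta>) = l (coord_covec A c ?q w)"
        using \<eta> by fastforce
      then show ?thesis using V(3)[OF that] by (simp add: p(2) pair)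
    qed
    from this[OF subspace_diff[OF V(1) p(1) V(2)]] have "(p - R) \<bullet> s (x, p - R) = 0"
      by (simp add: linear_diff[OF simple_coordsD(3)[OF sF x]] inner_diff_right)
    then have "p = R" using simple_coordsD(5)[OF sF x, of "p - R"] by auto
    then show "\<eta> = (?q, coord_covec A c ?q R)" using p by simp
  qed
qed

context
  fixes H Hhat :: "'q \<times> ('q, 'e) covec \<Rightarrow> real" and W :: "('q \<times> ('q, 'e) covec) set"
  assumes H: "simple_hamiltonian A H" and Hhat: "simple_hamiltonian A Hhat"
    and W: "linear_subbundle B X A W"
begin

abbreviation "FD \<equiv> fiber_derivative A Hhat"
abbreviation "PB \<equiv> poisson_bracket B A Hhat H"

lemma fiber_subset: "fiber W q \<subseteq> {\<alpha> \<in> cotangent_bundle A. fst \<alpha> = q}"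
  using W by (auto simp: fiber_def linear_subbundle_def)

section \<open>Necessity: a control forces the bracket to vanish\<close>

lemma bracket_zero_if_control:
  assumes mu: "\<And>\<alpha>. \<alpha> \<in> cotangent_bundle A \<Longrightarrow> 0 \<le> \<mu> \<alpha>"
    and y: "\<And>\<alpha>. \<alpha> \<in> cotangent_bundle A \<Longrightarrow> pairing (y \<alpha>) (FD \<alpha>) = - \<mu> \<alpha> - PB \<alpha>"
      "\<And>\<alpha>. \<alpha> \<in> cotangent_bundle A \<Longrightarrow> y \<alpha> \<in> fiber W (fst \<alpha>)"
    and \<sigma>: "\<sigma> \<in> cotangent_bundle A" "FD \<sigma> \<in> annihilator A W"
  shows "PB \<sigma> = 0"
proof -
  obtain q a where qa: "\<sigma> = (q, a)" by fastforce
  then have "q \<in> points A" using \<sigma>(1) by (simp add: cotangent_bundle_def)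
  then obtain c where cq: "c \<in> charts_at A q" by (rule obtain_chart)
  note c = charts_atD(1)[OF cq]
  have "fst \<sigma> \<in> fst c" using charts_atD(2)[OF cq] by (simp add: qa)
  then obtain x p where x: "x \<in> snd c ` fst c" and \<sigma>_eq: "\<sigma> = (chart_inv c x, coord_covec A c (chart_inv c x) p)"
    using cotangent_bundle_cases[OF \<sigma>(1) c] by metis
  let ?q = "chart_inv c x"
  note q = chart_inv_charts_at[OF c x]
  obtain s k where s: "simple_coords Hhat c s k" using simple_coords_exist[OF Hhat c] .
  obtain s' k' where s': "simple_coords H c s' k'" using simple_coords_exist[OF H c] .
  \<comment> \<open>\<open>y\<close> may take unrelated values at different \<open>t\<close>: each
    lies in \<open>W\<close> and so pairs to 0 with \<open>s (x, p)\<close>, hence with its multiple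
    \<open>s (x, t *\<^sub>R p)\<close>.\<close>
  have nonpos: "PB (?q, coord_covec A c ?q (t *\<^sub>R p)) \<le> 0" for t
  proof -
    let ?\<alpha> = "(?q, coord_covec A c ?q (t *\<^sub>R p))"
    have \<alpha>: "?\<alpha> \<in> cotangent_bundle A" using q by (rule coord_covec_bundle)
    have "y ?\<alpha> \<in> fiber W ?q" using y(2)[OF \<alpha>] by simp
    moreover then have "y ?\<alpha> \<in> cotangent_bundle A" "fst (y ?\<alpha>) = ?q" using fiber_subset by auto
    then obtain r where r: "y ?\<alpha> = (?q, coord_covec A c ?q r)"
      using coord_covec_momentum[OF q, of "snd (y ?\<alpha>)"]
      by (metis (mono_tags, lifting) case_prod_conv cotangent_bundle_def mem_Collect_eq prod.collapse)
    ultimately have "pairing (?q, coord_covec A c ?q r) (FD \<sigma>) = 0"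
      using \<sigma>(2) by (auto simp: annihilator_def \<sigma>_eq simple_coordsD(7)[OF s x])
    then have "r \<bullet> s (x, p) = 0" by (simp add: \<sigma>_eq simple_coordsD(7)[OF s x] pairing_def q)
    then have "pairing (y ?\<alpha>) (FD ?\<alpha>) = 0"
      by (simp add: r simple_coordsD(7)[OF s x] pairing_def q linear_scale[OF simple_coordsD(3)[OF s x]])
    then show ?thesis using y(1)[OF \<alpha>] mu[OF \<alpha>] by simp
  qed
  have "PB (?q, coord_covec A c ?q (- p)) = - PB (?q, coord_covec A c ?q p)"
    by (simp add: poisson_bracket_coords[OF Hhat H c x] local_bracket_odd[OF s s' c x])
  then show ?thesis using nonpos[of 1] nonpos[of "- 1"] by (simp add: \<sigma>_eq)
qed

text \<open>One local formula settles existence, the equation, and smoothness jointly in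
  \<open>x\<close> and \<open>p\<close>. \<open>U\<close> is the domain of a local frame of
  \<open>W\<close> in the base, so all momenta over it are covered.\<close>

lemma control_coords:
  assumes zero: "\<And>\<sigma>. \<sigma> \<in> cotangent_bundle A \<Longrightarrow> FD \<sigma> \<in> annihilator A W \<Longrightarrow> PB \<sigma> = 0"
    and c: "c \<in> A" and q0: "q0 \<in> fst c"
  obtains U Y where "openin X U" "q0 \<in> U" "smooth_on (snd c ` (fst c \<inter> U) \<times> UNIV) Y"
    "\<And>x p. x \<in> snd c ` (fst c \<inter> U) \<Longrightarrow> control W FD PB (chart_inv c x, coord_covec A c (chart_inv c x) p) =
      (chart_inv c x, coord_covec A c (chart_inv c x) (Y (x, p)))"
    "\<And>x p. x \<in> snd c ` (fst c \<inter> U) \<Longrightarrow> (chart_inv c x, coord_covec A c (chart_inv c x) (Y (x, p))) \<in> fiber W (chart_inv c x)"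
    "\<And>x p. x \<in> snd c ` (fst c \<inter> U) \<Longrightarrow>
      pairing (chart_inv c x, coord_covec A c (chart_inv c x) (Y (x, p)))
        (FD (chart_inv c x, coord_covec A c (chart_inv c x) p)) =
      - PB (chart_inv c x, coord_covec A c (chart_inv c x) p)"
proof -
  obtain s k where s: "simple_coords Hhat c s k" using simple_coords_exist[OF Hhat c] .
  obtain s' k' where s': "simple_coords H c s' k'" using simple_coords_exist[OF H c] .
  obtain U om and m :: nat where U: "openin X U" "q0 \<in> U"
    and om: "\<And>i. i < m \<Longrightarrow> smooth_on (snd c ` (fst c \<inter> U)) (om i)"
    and ind: "\<And>i x. i < m \<Longrightarrow> x \<in> snd c ` (fst c \<inter> U) \<Longrightarrow> om i x \<notin> span ((\<lambda>j. om j x) ` {..<i})"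
    and fib: "\<And>x. x \<in> snd c ` (fst c \<inter> U) \<Longrightarrow> fiber W (chart_inv c x) =
      (\<lambda>p. (chart_inv c x, coord_covec A c (chart_inv c x) p)) ` span ((\<lambda>j. om j x) ` {..<m})"
    using subbundle_coords[OF W c q0] by metis
  let ?V = "snd c ` (fst c \<inter> U)"
  let ?S = "?V \<times> (UNIV :: 'e set)" and ?M = "snd c ` fst c \<times> (UNIV :: 'e set)"
  let ?W = "\<lambda>x. span ((\<lambda>j. om j x) ` {..<m})"
  have V: "x \<in> snd c ` fst c" if "x \<in> ?V" for x using that by auto
  have SM: "?S \<subseteq> ?M" by auto
  have opV: "open ?V" by (rule open_chart_overlap[OF c U(1)])
  have opS: "open ?S" by (intro open_Times opV open_UNIV)
  have opM: "open ?M" by (rule open_chart_image_prod[OF c])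
  have fst_S: "smooth_on ?S fst" and snd_S: "smooth_on ?S snd"
    by (auto intro: smooth_on_bounded_linear opS bounded_linear_fst bounded_linear_snd)
  have s_S: "smooth_on ?S s" using simple_coordsD(1)[OF s] SM by (rule smooth_on_subset)
  have comp: "smooth_on ?S (\<lambda>z. f (fst z, g z))" if "smooth_on ?M f" "smooth_on ?S g"
    for f :: "'e \<times> 'e \<Rightarrow> real" and g
    by (rule smooth_on_compose[OF onb2 opS opM _ that(1) smooth_on_Pair[OF opS fst_S that(2)]]) auto
  have compE: "smooth_on ?S (\<lambda>z. f (fst z, g z))" if "smooth_on ?M f" "smooth_on ?S g"
    for f :: "'e \<times> 'e \<Rightarrow> 'e" and g
    by (rule smooth_on_compose[OF onb2 opS opM _ that(1) smooth_on_Pair[OF opS fst_S that(2)]]) auto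
  \<comment> \<open>The inner product is the cometric and the frame depends on the base point only,
    while the functional may depend on the momentum too.\<close>
  have riesz: "\<exists>R. smooth_on ?S R \<and> (\<forall>z\<in>?S. R z \<in> ?W (fst z) \<and> (\<forall>w\<in>?W (fst z). w \<bullet> s (fst z, R z) = l z w))"
    if "\<And>z. z \<in> ?S \<Longrightarrow> linear (l z)" "\<And>u. smooth_on ?S (\<lambda>z. l z u)" for l
  proof (rule smooth_riesz[OF onb opS, where g = "\<lambda>z u w. w \<bullet> s (fst z, u)" and \<omega> = "\<lambda>i z. om i (fst z)"])
    show "smooth_on ?S (\<lambda>z. w \<bullet> s (fst z, u))" for u w
      by (intro smooth_on_inner opS smooth_on_const compE simple_coordsD(1)[OF s])
    show "smooth_on ?S (\<lambda>z. om i (fst z))" if "i < m" for i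
      by (rule smooth_on_compose[OF onb opS opV _ om[OF that] fst_S]) auto
    show "linear (\<lambda>w. w \<bullet> s (fst z, u))" for z u
      by (simp add: linear_iff inner_add_left)
    show "w \<bullet> s (fst z, u) = u \<bullet> s (fst z, w)" if "z \<in> ?S" for z u w
      using that V by (intro simple_coordsD(4)[OF s]) auto
    show "0 < u \<bullet> s (fst z, u)" if "z \<in> ?S" "u \<noteq> 0" for z u
      using that V by (intro simple_coordsD(5)[OF s]) auto
    show "om i (fst z) \<notin> span ((\<lambda>j. om j (fst z)) ` {..<i})" if "i < m" "z \<in> ?S" for i z
      using that by (intro ind) auto
  qed (use that in auto)
  \<comment> \<open>The cometric projection of the momentum \<open>snd z\<close>: it has the same
    products with \<open>?W (fst z)\<close> as \<open>snd z\<close>.\<close>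
  obtain \<beta> where \<beta>: "smooth_on ?S \<beta>" "\<And>z. z \<in> ?S \<Longrightarrow> \<beta> z \<in> ?W (fst z)"
    "\<And>z w. z \<in> ?S \<Longrightarrow> w \<in> ?W (fst z) \<Longrightarrow> w \<bullet> s (fst z, \<beta> z) = w \<bullet> s z"
  proof -
    have "\<exists>R. smooth_on ?S R \<and> (\<forall>z\<in>?S. R z \<in> ?W (fst z) \<and> (\<forall>w\<in>?W (fst z). w \<bullet> s (fst z, R z) = w \<bullet> s z))"
      by (rule riesz) (auto simp: linear_iff inner_add_left intro!: smooth_on_inner opS smooth_on_const s_S)
    then show thesis using that by blast
  qed
  define br where "br = coordinate_bracket B (local_rep c Hhat) (local_rep c H)"
  have br: "smooth_on ?M br" unfolding br_def by (rule smooth_local_bracket[OF s s' c])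
  define D where "D z = frechet_derivative br (at z)" for z
  have D: "(br has_derivative D z) (at z)" if "z \<in> ?M" for z
    unfolding D_def by (rule smooth_on_has_derivative[OF br that])
  have D_lin: "linear (\<lambda>w. D z (0, w))" if "z \<in> ?M" for z
  proof -
    have "linear (\<lambda>w::'e. (0::'e, w))" by (simp add: linear_iff)
    from linear_compose[OF this has_derivative_linear[OF D[OF that]]] show ?thesis by (simp add: o_def)
  qed
  have D_smooth: "smooth_on ?M (\<lambda>z. D z v)" for v
    unfolding D_def by (rule smooth_on_derivative[OF br])
  \<comment> \<open>The three evaluation points are the parameters 0, 1/2 and 1 of the segment from
    \<open>snd z - \<beta> z\<close> to \<open>snd z\<close>.\<close>
  define N where "N z w = (D (fst z, snd z - \<beta> z) (0, w) + 4 * D (fst z, snd z - (1/2) *\<^sub>R \<beta> z) (0, w) + D z (0, w)) * (1/6)"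
    for z w
  have N_lin: "linear (\<lambda>w. - N z w)" if "z \<in> ?S" for z
  proof -
    have M: "(fst z, r) \<in> ?M" "z \<in> ?M" for r using that V by auto
    from D_lin[OF M(1), of "snd z - \<beta> z"] D_lin[OF M(1), of "snd z - (1/2) *\<^sub>R \<beta> z"] D_lin[OF M(2)]
    show ?thesis by (simp add: N_def linear_iff algebra_simps add_divide_distrib)
  qed
  have N_smooth: "smooth_on ?S (\<lambda>z. - N z w)" for w
  proof -
    have "smooth_on ?S (\<lambda>z. (- 1) * N z w)"
      unfolding N_def
      by (intro smooth_on_mult smooth_on_add opS smooth_on_const comp[OF D_smooth] smooth_on_diff snd_S
          smooth_on_scaleR \<beta>(1) smooth_on_subset[OF D_smooth SM])
    then show ?thesis by simp
  qed
  obtain Y where Y: "smooth_on ?S Y" "\<And>z. z \<in> ?S \<Longrightarrow> Y z \<in> ?W (fst z)"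
    "\<And>z w. z \<in> ?S \<Longrightarrow> w \<in> ?W (fst z) \<Longrightarrow> w \<bullet> s (fst z, Y z) = - N z w"
    using riesz[of "\<lambda>z w. - N z w", OF N_lin N_smooth] by blast
  show thesis
  proof (rule that[OF U Y(1)])
    fix x p assume x: "x \<in> ?V"
    let ?q = "chart_inv c x"
    let ?a = "\<lambda>p. coord_covec A c ?q p"
    note xc = V[OF x]
    note q = chart_inv_charts_at[OF c xc]
    have z: "(x, p) \<in> ?S" using x by simp
    have zM: "(x, r) \<in> ?M" for r using xc by simp
    have PB_eq: "PB (?q, ?a r) = br (x, r)" for r
      unfolding br_def by (rule poisson_bracket_coords[OF Hhat H c xc])
    have shift: "covec_shift (?q, ?a r) t (?a w) = (?q, ?a (r + t *\<^sub>R w))" for r t w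
      using coord_covec_lin[OF q, of 1 r t w] by (simp add: covec_shift_def)
    have line: "((\<lambda>t. br (x, r + t *\<^sub>R w)) has_real_derivative D (x, r + t *\<^sub>R w) (0, w)) (at t)" for r w t
      using has_derivative_along_line[of br "D (x, r + t *\<^sub>R w)" "(x, r)" t "(0, w)"] D[OF zM] by simp
    have deriv_PB: "deriv (\<lambda>t. PB (?q, ?a (r + t *\<^sub>R w))) 0 = D (x, r) (0, w)" for r w
      using DERIV_imp_deriv[OF line[of r w 0]] by (simp add: PB_eq)
    have orth: "orthogonal_part W FD (?q, ?a p) = (?q, ?a (\<beta> (x, p)))"
      unfolding orthogonal_part_def fst_conv
    \<comment> \<open>\<open>l\<close> receives only the covector \<open>snd \<omega>\<close>;
      unfolding and refolding \<open>pairing\<close> restores \<open>pairing \<omega>\<close>, as in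
      \<open>orthogonal_part\<close>.\<close>
    proof (rule fiber_riesz_unique[OF s c xc subspace_span _ _ fib[OF x],
          where l = "\<lambda>a. pairing (?q, a) (FD (?q, ?a p))", unfolded pairing_def snd_conv, folded pairing_def])
      show "\<beta> (x, p) \<in> ?W x" using \<beta>(2)[OF z] by simp
      show "w \<bullet> s (x, \<beta> (x, p)) = ?a w (snd (FD (?q, ?a p)))" if "w \<in> ?W x" for w
        using \<beta>(3)[OF z, of w] that by (simp add: simple_coordsD(7)[OF s xc] q)
    qed
    have mean: "mean_derivative PB (?a (\<beta> (x, p))) (?q, ?a p) (?a w) = N (x, p) w" for w
      unfolding mean_derivative_def shift deriv_PB by (simp add: N_def)
    show "control W FD PB (?q, ?a p) = (?q, ?a (Y (x, p)))"
      unfolding control_def fst_conv orth snd_conv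
    proof (rule fiber_riesz_unique[OF s c xc subspace_span _ _ fib[OF x]])
      show "Y (x, p) \<in> ?W x" using Y(2)[OF z] by simp
      show "w \<bullet> s (x, Y (x, p)) = - mean_derivative PB (?a (\<beta> (x, p))) (?q, ?a p) (?a w)" if "w \<in> ?W x" for w
        using Y(3)[OF z, of w] that by (simp add: mean)
    qed
    show "(?q, ?a (Y (x, p))) \<in> fiber W ?q"
      unfolding fib[OF x] using Y(2)[OF z] by simp
    let ?b = "\<beta> (x, p)"
    have "(?q, ?a (p - ?b)) \<in> cotangent_bundle A" using q by (rule coord_covec_bundle)
    \<comment> \<open>Orthogonality of the difference to \<open>W\<close> is exactly this
      membership; here the hypothesis \<open>zero\<close> becomes applicable.\<close>
    moreover have "FD (?q, ?a (p - ?b)) \<in> annihilator A W"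
    proof -
      have "w \<bullet> s (x, p - ?b) = 0" if "w \<in> ?W x" for w
        using \<beta>(3)[OF z, of w] that by (simp add: linear_diff[OF simple_coordsD(3)[OF s xc]] inner_diff_right)
      then show ?thesis
        unfolding annihilator_def simple_coordsD(7)[OF s xc]
        by (auto simp: tangent_bundle_def charts_at_points[OF q] q fib[OF x] pairing_def)
    qed
    ultimately have "br (x, p - ?b) = 0" using zero by (simp flip: PB_eq)
    moreover have "br (x, p) - br (x, p - ?b) = N (x, p) ?b"
    proof -
      obtain a0 a1 a2 a3 where
        cubic: "\<And>t. br (x, (p - ?b) + t *\<^sub>R ?b) = a0 + a1 * t + a2 * t^2 + a3 * t^3"
        using local_bracket_cubic[OF s s' c xc] unfolding br_def by metis
      have half: "(p - ?b) + (1/2) *\<^sub>R ?b = p - (1/2) *\<^sub>R ?b"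
        by (simp add: algebra_simps flip: scaleR_add_left)
      show ?thesis using simpson_cubic[OF cubic line] unfolding half by (simp add: N_def)
    qed
    \<comment> \<open>\<open>Y (x, p)\<close> lies in \<open>?W x\<close> and sees \<open>p\<close>
      only through the projection \<open>?b\<close>; symmetry then allows its defining property to
      be evaluated at \<open>?b\<close>, which also lies in \<open>?W x\<close>.\<close>
    moreover have "Y (x, p) \<bullet> s (x, p) = - N (x, p) ?b"
    proof -
      have "Y (x, p) \<bullet> s (x, p) = Y (x, p) \<bullet> s (x, ?b)" using \<beta>(3)[OF z] Y(2)[OF z] by simp
      also have "\<dots> = ?b \<bullet> s (x, Y (x, p))" by (rule simple_coordsD(4)[OF s xc])
      also have "\<dots> = - N (x, p) ?b" using Y(3)[OF z] \<beta>(2)[OF z] by simp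
      finally show ?thesis .
    qed
    ultimately show "pairing (?q, ?a (Y (x, p))) (FD (?q, ?a p)) = - PB (?q, ?a p)"
      by (simp add: PB_eq simple_coordsD(7)[OF s xc] pairing_def q)
  qed
qed

section \<open>Sufficiency: the global control\<close>

context
  assumes zero: "\<And>\<sigma>. \<sigma> \<in> cotangent_bundle A \<Longrightarrow> FD \<sigma> \<in> annihilator A W \<Longrightarrow> PB \<sigma> = 0"
begin

abbreviation "Y \<equiv> control W FD PB"

lemma control_props:
  assumes \<alpha>: "\<alpha> \<in> cotangent_bundle A"
  shows "Y \<alpha> \<in> fiber W (fst \<alpha>)" "pairing (Y \<alpha>) (FD \<alpha>) = - PB \<alpha>"
proof -
  have "fst \<alpha> \<in> points A" using \<alpha> by (auto simp: cotangent_bundle_def)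
  then obtain c where "c \<in> charts_at A (fst \<alpha>)" by (rule obtain_chart)
  note c = charts_atD[OF this]
  obtain x p where x: "x \<in> snd c ` fst c" "x = snd c (fst \<alpha>)"
    and \<alpha>_eq: "\<alpha> = (chart_inv c x, coord_covec A c (chart_inv c x) p)"
    using cotangent_bundle_cases[OF \<alpha> c] by metis
  from control_coords[OF zero c] obtain U Yc where U: "fst \<alpha> \<in> U"
    and Yc: "\<And>x p. x \<in> snd c ` (fst c \<inter> U) \<Longrightarrow> Y (chart_inv c x, coord_covec A c (chart_inv c x) p) =
      (chart_inv c x, coord_covec A c (chart_inv c x) (Yc (x, p)))"
      "\<And>x p. x \<in> snd c ` (fst c \<inter> U) \<Longrightarrow> (chart_inv c x, coord_covec A c (chart_inv c x) (Yc (x, p))) \<in> fiber W (chart_inv c x)"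
      "\<And>x p. x \<in> snd c ` (fst c \<inter> U) \<Longrightarrow>
        pairing (chart_inv c x, coord_covec A c (chart_inv c x) (Yc (x, p)))
          (FD (chart_inv c x, coord_covec A c (chart_inv c x) p)) =
        - PB (chart_inv c x, coord_covec A c (chart_inv c x) p)"
    by metis
  have "x \<in> snd c ` (fst c \<inter> U)" using x(2) c U by auto
  from Yc(1)[OF this, of p] Yc(2)[OF this, of p] Yc(3)[OF this, of p]
  show "Y \<alpha> \<in> fiber W (fst \<alpha>)" "pairing (Y \<alpha>) (FD \<alpha>) = - PB \<alpha>"
    by (simp_all flip: \<alpha>_eq) (simp_all add: \<alpha>_eq)
qed

lemma control_bundle:
  assumes "\<alpha> \<in> cotangent_bundle A"
  shows "Y \<alpha> \<in> cotangent_bundle A" "fst (Y \<alpha>) = fst \<alpha>"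
  using control_props(1)[OF assms] fiber_subset by auto

lemma smooth_control: "smooth_map (cotangent_atlas B A) (cotangent_atlas B A) Y"
  unfolding smooth_map_def
proof (intro conjI ballI)
  show "Y ` points (cotangent_atlas B A) \<subseteq> points (cotangent_atlas B A)"
    by (auto simp: points_cotangent_atlas control_bundle)
  fix C D assume "C \<in> cotangent_atlas B A" "D \<in> cotangent_atlas B A"
  then obtain c d where c: "c \<in> A" "C = cotangent_chart B A c" and d: "d \<in> A" "D = cotangent_chart B A d"
    by (auto simp: cotangent_atlas_def)
  let ?O = "snd c ` (fst c \<inter> fst d)"
  \<comment> \<open>Since \<open>Y\<close> preserves fibers, the preimage of a canonical chart
    domain is determined on the base, and the overlap contains whole fibers.\<close>
  have dom: "fst C \<inter> Y -` fst D = {\<alpha> \<in> cotangent_bundle A. fst \<alpha> \<in> fst c \<inter> fst d}"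
    by (auto simp: c d cotangent_chart_dom control_bundle)
  have img: "snd C ` (fst C \<inter> Y -` fst D) = ?O \<times> UNIV"
    unfolding dom unfolding c(2) by (rule cotangent_chart_image[OF c(1)])
  have opO: "open ?O" using c(1) d(1) by (rule open_overlap)
  show "open (snd C ` (fst C \<inter> Y -` fst D))"
    unfolding img by (intro open_Times opO open_UNIV)
  show "smooth_on (snd C ` (fst C \<inter> Y -` fst D)) (snd D \<circ> Y \<circ> chart_inv C)"
    unfolding img
  \<comment> \<open>The smooth formula for \<open>Y\<close> is available only over a frame
    neighbourhood of each base point.\<close>
  proof (rule smooth_on_local)
    fix z :: "'e \<times> 'e" assume "z \<in> ?O \<times> UNIV"
    then obtain q0 where q0: "q0 \<in> fst c" "q0 \<in> fst d" "fst z = snd c q0" by auto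
    from control_coords[OF zero c(1) q0(1)] obtain U Yc where U: "openin X U" "q0 \<in> U"
      and Yc_smooth: "smooth_on (snd c ` (fst c \<inter> U) \<times> UNIV) Yc"
      and Yc: "\<And>x p. x \<in> snd c ` (fst c \<inter> U) \<Longrightarrow> Y (chart_inv c x, coord_covec A c (chart_inv c x) p) =
        (chart_inv c x, coord_covec A c (chart_inv c x) (Yc (x, p)))"
      by metis
    let ?V = "snd c ` (fst c \<inter> (fst d \<inter> U))"
    let ?T = "?V \<times> (UNIV :: 'e set)"
    \<comment> \<open>Carries the formula from \<open>c\<close> to \<open>d\<close>: the
      \<open>b\<close> component of a momentum in \<open>d\<close> is the value of the covector on
      the coordinate vector of \<open>d\<close> along \<open>b\<close>, whose component in
      \<open>c\<close> is given by \<open>?D\<close>.\<close>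
    let ?D = "\<lambda>x b. frechet_derivative (transition d c) (at x) b"
    have opV: "open ?V" by (intro open_chart_overlap c(1) openin_Int openin_chart d(1) U(1))
    have opT: "open ?T" by (intro open_Times opV open_UNIV)
    have trans: "smooth_on ?T (\<lambda>z. transition c d (fst z))"
      by (rule smooth_on_compose[OF onb opT opO _ smooth_transition[OF c(1) d(1)]])
        (auto intro: smooth_on_bounded_linear opT bounded_linear_fst)
    have "smooth_on ?T (\<lambda>z. ?D (transition c d (fst z)) b)" for b
      by (rule smooth_on_compose[OF onb opT open_overlap[OF d(1) c(1)] _
            smooth_on_derivative[OF smooth_transition[OF d(1) c(1)]] trans])
        (use c(1) in auto)
    moreover have "smooth_on ?T Yc" using Yc_smooth by (rule smooth_on_subset) auto
    ultimately have smooth: "smooth_on ?T (\<lambda>z. (transition c d (fst z),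
        \<Sum>b\<in>B. (Yc z \<bullet> ?D (transition c d (fst z)) b) *\<^sub>R b))"
      by (intro smooth_on_Pair opT trans smooth_on_sum smooth_on_scaleR smooth_on_inner smooth_on_const)
    have "smooth_on ?T (snd D \<circ> Y \<circ> chart_inv C)"
    proof (rule smooth_on_cong[OF opT _ smooth])
      fix z assume "z \<in> ?T"
      then obtain x p where z: "z = (x, p)" and x: "x \<in> ?V" by auto
      let ?q = "chart_inv c x"
      have q: "?q \<in> fst c" "?q \<in> fst d" "snd c ?q = x" and xc: "x \<in> snd c ` fst c"
        and xU: "x \<in> snd c ` (fst c \<inter> U)"
        using x c(1) by auto
      have \<tau>: "transition c d x = snd d ?q" using transition_chart[OF c(1) q(1), of d] by (simp add: q(3))
      have "(snd D \<circ> Y \<circ> chart_inv C) z = snd D (?q, coord_covec A c ?q (Yc (x, p)))"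
        by (simp add: z c(2) chart_inv_cotangent_chart[OF c(1) xc] Yc[OF xU])
      also have "\<dots> = (snd d ?q, \<Sum>b\<in>B. (Yc (x, p) \<bullet> ?D (snd d ?q) b) *\<^sub>R b)"
        using charts_atI[OF c(1) q(1)] charts_atI[OF d(1) q(2)]
        by (simp add: d(2) cotangent_chart_apply momentum_def coord_covec_def coord_tvec_chart)
      finally show "(transition c d (fst z), \<Sum>b\<in>B. (Yc z \<bullet> ?D (transition c d (fst z)) b) *\<^sub>R b) =
          (snd D \<circ> Y \<circ> chart_inv C) z"
        by (simp add: z \<tau>)
    qed
    moreover have "z \<in> ?T" using q0 U(2) by (cases z) auto
    ultimately show "\<exists>T. open T \<and> z \<in> T \<and> smooth_on T (snd D \<circ> Y \<circ> chart_inv C)"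
      using opT by blast
  qed
qed

end

lemma smooth_map_const: "smooth_map (cotangent_atlas B A) real_atlas (\<lambda>_. r)"
proof -
  have "open (snd (cotangent_chart B A c) ` fst (cotangent_chart B A c))" if "c \<in> A" for c
  proof -
    have "snd (cotangent_chart B A c) ` fst (cotangent_chart B A c) = snd c ` fst c \<times> UNIV"
      using cotangent_chart_image[OF that, of UNIV] by (simp add: cotangent_chart_dom)
    then show ?thesis using open_chart_image_prod[OF that] by simp
  qed
  then show ?thesis
    by (auto simp: smooth_map_def real_atlas_def points_def cotangent_atlas_def o_def smooth_on_const)
qed

end

end

theorem theorem40:
  fixes B :: "'e::real_inner set"
    and X :: "'q topology"
    and A :: "('q, 'e) chart set"
    and H Hhat :: "'q \<times> ('q, 'e) covec \<Rightarrow> real"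
    and W :: "('q \<times> ('q, 'e) covec) set"
  assumes "orthonormal_basis B"
    and "smooth_manifold X A"
    and "simple_hamiltonian A H"
    and "linear_subbundle B X A W"
    and "simple_hamiltonian A Hhat"
  shows "(\<exists>\<mu> y.
            smooth_map (cotangent_atlas B A) real_atlas \<mu> \<and>
            (\<forall>\<alpha>\<in>cotangent_bundle A. 0 \<le> \<mu> \<alpha>) \<and>
            smooth_map (cotangent_atlas B A) (cotangent_atlas B A) y \<and>
            (\<forall>\<alpha>\<in>cotangent_bundle A. bundle_proj (y \<alpha>) = bundle_proj \<alpha>) \<and>
            (\<forall>\<alpha>\<in>cotangent_bundle A.
               pairing (y \<alpha>) (fiber_derivative A Hhat \<alpha>) = - \<mu> \<alpha> - poisson_bracket B A Hhat H \<alpha> \<and>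
               y \<alpha> \<in> fiber W (bundle_proj \<alpha>)))
         \<longleftrightarrow>
         (\<forall>\<sigma>\<in>{\<sigma>\<in>cotangent_bundle A. fiber_derivative A Hhat \<sigma> \<in> annihilator A W}.
            poisson_bracket B A Hhat H \<sigma> = 0)"
    (is "?control \<longleftrightarrow> ?zero")
proof -
  interpret smooth_atlas B X A using assms(1,2) by unfold_locales
  \<comment> \<open>Ordered as in the preceding context: \<open>H\<close>, \<open>Hhat\<close>,
    \<open>W\<close>.\<close>
  note facts = assms(3,5,4)
  show ?thesis
  proof
    assume ?control
    then show ?zero using bracket_zero_if_control[OF facts] by blast
  next
    assume ?zero
    then have zero: "PB H Hhat \<sigma> = 0" if "\<sigma> \<in> cotangent_bundle A" "FD Hhat \<sigma> \<in> annihilator A W" for \<sigma>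
      using that by blast
    show ?control
      by (intro exI[of _ "\<lambda>_. 0"] exI[of _ "control W (FD Hhat) (PB H Hhat)"])
        (simp add: smooth_map_const[OF facts] smooth_control[OF facts zero]
          control_props[OF facts zero] control_bundle[OF facts zero])
  qed
qed

end
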